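(* Let $X$ be a compact locally uniquely geodesic metric space such that $\pi_n(X)\neq 0$ for some integer $n\geq 1$. Then $X$ contains a periodic geodesic.
   Context: For a metric space $(X,d)$ and a continuous path $\gamma:[a,b]\to X$, the length is $\mathrm{length}(\gamma)=\sup\{\sum_{i=1}^{m} d(\gamma(t_i),\gamma(t_{i+1})) : a=t_1<\dots<t_{m+1}=b,\ m\in\mathbb{N}\}$. The path $\gamma$ is a shortest path if $d(\gamma(a),\gamma(b))=\mathrm{length}(\gamma)$. $X$ is a geodesic metric space if it is nonempty and any two points of $X$ can be joined by a shortest path (so $X$ is path connected, and the condition $\pi_n(X)\ne 0$ does not depend on the base point). Paths are parametrized proportionally to arc length, and uniqueness of a shortest path is understood for this parametrization on $[0,1]$. A compact geodesic metric space $X$ is locally uniquely geodesic if there is $\epsilon>0$ such that any two points $x,y\in X$ with $d(x,y)\leq\epsilon$ can be joined by a unique shortest path. A periodic geodesic in $X$ is a nonconstant continuous map $\gamma:S^1=\mathbb{R}/\mathbb{Z}\to X$, of finite length and parametrized proportionally to arc length, for which there is $\delta>0$ such that, viewing $\gamma$ as a $1$-periodic map $\mathbb{R}\to X$, $d(\gamma(s),\gamma(t))=\mathrm{length}(\gamma|_{[s,t]})$ for all real $s\leq t$ with $t-s<\delta$. *)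

theory Defs
  imports "HOL-Analysis.Analysis"
begin

text \<open>
  A metric space is a subset \<open>X\<close> of a type of class \<open>metric_space\<close>, with the restricted distance.
\<close>

text \<open>
  The subdivision points are indexed from \<open>0\<close> to \<open>m\<close>. The case \<open>m = 0\<close> occurs only for \<open>a = b\<close>,
  where it gives the length \<open>0\<close>. For \<open>b < a\<close> the value is the meaningless supremum of the empty
  set; every use below has \<open>a \<le> b\<close>.
\<close>
definition path_length :: "real \<Rightarrow> real \<Rightarrow> (real \<Rightarrow> 'a::metric_space) \<Rightarrow> ereal" where
  "path_length a b \<gamma> =
     Sup {ereal (\<Sum>i<m. dist (\<gamma> (t i)) (\<gamma> (t (Suc i)))) | (m::nat) (t::nat \<Rightarrow> real).
            t 0 = a \<and> t m = b \<and> (\<forall>i<m. t i < t (Suc i))}"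

definition shortest_path :: "'a::metric_space set \<Rightarrow> real \<Rightarrow> real \<Rightarrow> (real \<Rightarrow> 'a) \<Rightarrow> bool" where
  "shortest_path X a b \<gamma> \<longleftrightarrow>
     a \<le> b \<and> continuous_on {a..b} \<gamma> \<and> \<gamma> ` {a..b} \<subseteq> X \<and>
     ereal (dist (\<gamma> a) (\<gamma> b)) = path_length a b \<gamma>"

definition arclength_proportional_on :: "real set \<Rightarrow> (real \<Rightarrow> 'a::metric_space) \<Rightarrow> bool" where
  "arclength_proportional_on I \<gamma> \<longleftrightarrow>
     (\<exists>c::real. \<forall>s\<in>I. \<forall>t\<in>I. s \<le> t \<longrightarrow> path_length s t \<gamma> = ereal (c * (t - s)))"

definition geodesic_space :: "'a::metric_space set \<Rightarrow> bool" where
  "geodesic_space X \<longleftrightarrow>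
     X \<noteq> {} \<and> (\<forall>x\<in>X. \<forall>y\<in>X. \<exists>a b \<gamma>. shortest_path X a b \<gamma> \<and> \<gamma> a = x \<and> \<gamma> b = y)"

definition normalized_shortest_path ::
  "'a::metric_space set \<Rightarrow> 'a \<Rightarrow> 'a \<Rightarrow> (real \<Rightarrow> 'a) \<Rightarrow> bool" where
  "normalized_shortest_path X x y \<gamma> \<longleftrightarrow>
     shortest_path X 0 1 \<gamma> \<and> arclength_proportional_on {0..1} \<gamma> \<and> \<gamma> 0 = x \<and> \<gamma> 1 = y"

text \<open>
  Paths are total functions, so uniqueness means equality on \<open>{0..1}\<close>.
\<close>
definition locally_uniquely_geodesic :: "'a::metric_space set \<Rightarrow> bool" where
  "locally_uniquely_geodesic X \<longleftrightarrow>
     geodesic_space X \<and>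
     (\<exists>\<epsilon>>0. \<forall>x\<in>X. \<forall>y\<in>X. dist x y \<le> \<epsilon> \<longrightarrow>
        (\<exists>\<gamma>. normalized_shortest_path X x y \<gamma> \<and>
             (\<forall>\<gamma>'. normalized_shortest_path X x y \<gamma>' \<longrightarrow> (\<forall>t\<in>{0..1}. \<gamma>' t = \<gamma> t))))"

text \<open>
  A map on the circle \<open>\<real>/\<int>\<close> is given as a \<open>1\<close>-periodic map on the real line.
\<close>
definition periodic_geodesic :: "'a::metric_space set \<Rightarrow> (real \<Rightarrow> 'a) \<Rightarrow> bool" where
  "periodic_geodesic X \<gamma> \<longleftrightarrow>
     continuous_on UNIV \<gamma> \<and> range \<gamma> \<subseteq> X \<and> (\<forall>t. \<gamma> (t + 1) = \<gamma> t) \<and>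
     (\<exists>s t. \<gamma> s \<noteq> \<gamma> t) \<and>
     path_length 0 1 \<gamma> < \<infinity> \<and>
     arclength_proportional_on UNIV \<gamma> \<and>
     (\<exists>\<delta>>0. \<forall>s t. s \<le> t \<and> t - s < \<delta> \<longrightarrow> ereal (dist (\<gamma> s) (\<gamma> t)) = path_length s t \<gamma>)"

definition unit_cube :: "nat \<Rightarrow> (nat \<Rightarrow> real) topology" where
  "unit_cube n = product_topology (\<lambda>_. top_of_set {0..1}) {..<n}"

definition unit_cube_boundary :: "nat \<Rightarrow> (nat \<Rightarrow> real) set" where
  "unit_cube_boundary n = {x \<in> topspace (unit_cube n). \<exists>i<n. x i = 0 \<or> x i = 1}"

definition spheroids :: "nat \<Rightarrow> 'a topology \<Rightarrow> 'a \<Rightarrow> ((nat \<Rightarrow> real) \<Rightarrow> 'a) set" where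
  "spheroids n T p =
     {f. continuous_map (unit_cube n) T f \<and> f ` unit_cube_boundary n \<subseteq> {p}}"

definition spheroid_homotopy ::
  "nat \<Rightarrow> 'a topology \<Rightarrow> 'a \<Rightarrow> (((nat \<Rightarrow> real) \<Rightarrow> 'a) \<times> ((nat \<Rightarrow> real) \<Rightarrow> 'a)) set" where
  "spheroid_homotopy n T p =
     {(f, g). homotopic_with (\<lambda>h. h ` unit_cube_boundary n \<subseteq> {p}) (unit_cube n) T f g}"

text \<open>
  The underlying set of \<open>\<pi>\<^sub>n(T, p)\<close>: maps of pairs from the \<open>n\<close>-cube and its boundary to
  \<open>(T, {p})\<close>, up to homotopy through such maps. The class of the constant map is the neutral
  element of the group, so \<open>\<pi>\<^sub>n(T, p) \<noteq> 0\<close> says that there is another class; the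
  multiplication plays no role in this.
\<close>
definition homotopy_classes :: "nat \<Rightarrow> 'a topology \<Rightarrow> 'a \<Rightarrow> ((nat \<Rightarrow> real) \<Rightarrow> 'a) set set" where
  "homotopy_classes n T p = spheroids n T p // spheroid_homotopy n T p"

definition nontrivial_homotopy_group :: "nat \<Rightarrow> 'a topology \<Rightarrow> 'a \<Rightarrow> bool" where
  "nontrivial_homotopy_group n T p \<longleftrightarrow>
     homotopy_classes n T p \<noteq> {spheroid_homotopy n T p `` {\<lambda>_. p}}"

lemma equiv_spheroid_homotopy: "equiv (spheroids n T p) (spheroid_homotopy n T p)"
proof (rule equivI)
  show "spheroid_homotopy n T p \<subseteq> spheroids n T p \<times> spheroids n T p"
  proof (clarify)
    fix f g assume "(f, g) \<in> spheroid_homotopy n T p"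
    then have h: "homotopic_with (\<lambda>h. h ` unit_cube_boundary n \<subseteq> {p}) (unit_cube n) T f g"
      by (simp only: spheroid_homotopy_def mem_Collect_eq prod.case)
    show "f \<in> spheroids n T p \<and> g \<in> spheroids n T p"
      using homotopic_with_imp_continuous_maps[OF h] homotopic_with_imp_property[OF h]
      by (simp only: spheroids_def mem_Collect_eq simp_thms)
  qed
  show "refl_on (spheroids n T p) (spheroid_homotopy n T p)"
    by (simp add: refl_on_def spheroid_homotopy_def spheroids_def)
  show "sym (spheroid_homotopy n T p)"
    unfolding sym_def spheroid_homotopy_def
    by (simp only: mem_Collect_eq prod.case) (blast intro: homotopic_with_symD)
  show "trans (spheroid_homotopy n T p)"
    unfolding trans_def spheroid_homotopy_def
    by (simp only: mem_Collect_eq prod.case) (blast intro: homotopic_with_trans)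
qed

lemma const_in_spheroids: "p \<in> topspace T \<Longrightarrow> (\<lambda>_. p) \<in> spheroids n T p"
  unfolding spheroids_def by auto

end

theory Submission
  imports Defs
begin

text \<open>
  Suppose that there is no periodic geodesic. Then every family of loops can be shortened to a
  family of constant loops, and this makes every spheroid null-homotopic.

  Unique shortest paths depend continuously on their end points. By
  \<open>locally_uniquely_geodesic_between\<close>, the point \<open>geod x y t\<close> at time \<open>t\<close> is determined by its
  distances to \<open>x\<close> and \<open>y\<close>, so its graph is closed and compactness of \<open>X\<close> gives continuity. Loops
  are then replaced by closed polygons with a fixed number \<open>N\<close> of vertices and edges of length at
  most \<open>\<epsilon>\<close>. The polygons form a compact space.

  The shortening step replaces a polygon by the polygon of the midpoints of its edges. If the edges
  have lengths \<open>d i\<close>, then those of the new polygon are at most \<open>(d i + d (i + 1)) / 2\<close>, so the sum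
  of the squares of the edge lengths does not increase. It stays the same only if all edges have
  the same length \<open>c\<close> and consecutive midpoints have distance \<open>c\<close>. Then the path from one midpoint
  to the next through the vertex between them is a shortest path, and for \<open>c > 0\<close> the polygon is a
  periodic geodesic (\<open>periodic_geodesic_of_taut_polygon\<close>). As there is none, the sum of squares
  decreases strictly on all nonconstant polygons. By compactness, a fixed number of steps makes all
  polygons small at once, and small polygons contract along shortest paths. Each step is
  homotopic to the identity, because the vertices can slide along the edges to the midpoints.
  Hence the space of polygons deforms into the constant polygons, while constant polygons stay where
  they are (\<open>polygons_deform_to_constants\<close>).

  A spheroid is a family of loops at \<open>p\<close> in the direction of its first coordinate. It is homotopic
  to the family of inscribed polygons, to which the deformation applies. Base points
  move during the deformation. A loop which is freely homotopic to a constant loop is, with fixed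
  end points, homotopic to the track of its base point followed by the same track backwards, and
  this path can be retracted. All these homotopies are continuous in the parameters and constant on
  the boundary of the cube (\<open>null_homotopic_of_contraction\<close>). So every spheroid is null-homotopic,
  which contradicts the nontrivial homotopy group.
\<close>

section \<open>Compactness and cyclic sums\<close>

text \<open>
  The projection along a compact factor is a closed map, so preimages of closed sets are closed.
\<close>
lemma continuous_on_of_closed_graph:
  assumes "compact T" and fim: "f \<in> S \<rightarrow> T"
    and clo: "closedin (top_of_set (S \<times> T)) ((\<lambda>x. (x, f x)) ` S)"
  shows "continuous_on S f"
  unfolding continuous_on_closed_gen[OF fim]
proof (intro allI impI)
  fix U assume U: "closedin (top_of_set T) U"
  have eq: "(S \<inter> f -` U) = fst ` (((\<lambda>x. (x, f x)) ` S) \<inter> (S \<times> U))"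
    by (force simp: image_iff)
  have "closed_map (prod_topology (top_of_set S) (top_of_set T)) (top_of_set S) fst"
    by (rule closed_map_fst) (use \<open>compact T\<close> in \<open>simp add: compact_space_subtopology\<close>)
  moreover have "closedin (top_of_set (S \<times> T)) ((\<lambda>x. (x, f x)) ` S \<inter> S \<times> U)"
    using U by (intro closedin_Int clo closedin_Times) auto
  ultimately show "closedin (top_of_set S) (S \<inter> f -` U)"
    unfolding eq by (simp add: closed_map_def)
qed

text \<open>
  Where \<open>E\<close> is at least \<open>\<eta>\<close>, compactness gives the strict decrease of \<open>E\<close> a positive lower bound.
  An orbit therefore leaves that region after a number of steps that does not depend on its
  starting point, and it cannot come back.
\<close>
lemma iterates_small:
  fixes E :: "'b::topological_space \<Rightarrow> real"
  assumes S: "compact S" and \<Phi>: "\<Phi> \<in> S \<rightarrow> S"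
    and cont: "continuous_on S \<Phi>" "continuous_on S E"
    and nonneg: "\<And>x. x \<in> S \<Longrightarrow> 0 \<le> E x"
    and le: "\<And>x. x \<in> S \<Longrightarrow> E (\<Phi> x) \<le> E x"
    and less: "\<And>x. \<lbrakk>x \<in> S; 0 < E x\<rbrakk> \<Longrightarrow> E (\<Phi> x) < E x"
    and \<eta>: "0 < \<eta>"
  shows "\<exists>k. \<forall>x\<in>S. E ((\<Phi> ^^ k) x) < \<eta>"
proof -
  define K where "K = {x \<in> S. \<eta> \<le> E x}"
  have "\<exists>\<kappa>>0. \<forall>x\<in>K. \<kappa> \<le> E x - E (\<Phi> x)"
  proof (cases "K = {}")
    case True
    then show ?thesis by (auto intro: exI[of _ 1])
  next
    case False
    have "closedin (top_of_set S) (S \<inter> E -` {\<eta>..})"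
      using cont by (intro continuous_closedin_preimage) auto
    also have "S \<inter> E -` {\<eta>..} = K" by (auto simp: K_def)
    finally have "compact K"
      using S closedin_compact by blast
    moreover have "continuous_on S (\<lambda>x. E (\<Phi> x))"
      using continuous_on_compose[OF cont(1) continuous_on_subset[OF cont(2)]] \<Phi>
      by (auto simp: o_def)
    then have "continuous_on K (\<lambda>x. E x - E (\<Phi> x))"
      using cont by (auto simp: K_def intro!: continuous_on_diff intro: continuous_on_subset)
    ultimately have "\<exists>x\<in>K. \<forall>y\<in>K. E x - E (\<Phi> x) \<le> E y - E (\<Phi> y)"
      using False by (intro continuous_attains_inf)
    then obtain x where x: "x \<in> K" "\<And>y. y \<in> K \<Longrightarrow> E x - E (\<Phi> x) \<le> E y - E (\<Phi> y)"
      by blast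
    then have "0 < E x - E (\<Phi> x)"
      using less[of x] \<eta> by (auto simp: K_def)
    with x show ?thesis by blast
  qed
  then obtain \<kappa> where \<kappa>: "0 < \<kappa>" "\<And>x. \<lbrakk>x \<in> S; \<eta> \<le> E x\<rbrakk> \<Longrightarrow> \<kappa> \<le> E x - E (\<Phi> x)"
    by (auto simp: K_def)
  have "compact (E ` S)"
    using S cont by (intro compact_continuous_image)
  then obtain M where M: "\<And>x. x \<in> S \<Longrightarrow> E x \<le> M"
    using compact_imp_bounded bounded_has_Sup(1)[of "E ` S"] by (metis empty_iff image_eqI)
  have orbit: "(\<Phi> ^^ k) x \<in> S" if "x \<in> S" for k x
    using that \<Phi> by (induction k) auto
  have drop: "E ((\<Phi> ^^ k) x) < \<eta> \<or> E ((\<Phi> ^^ k) x) \<le> M - real k * \<kappa>" if x: "x \<in> S" for k x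
  proof (induction k)
    case (Suc k)
    show ?case
    proof (cases "E ((\<Phi> ^^ k) x) < \<eta>")
      case True
      then show ?thesis using le[OF orbit[OF x, of k]] by simp
    next
      case False
      then show ?thesis using Suc \<kappa>(2)[OF orbit[OF x, of k]] by (simp add: algebra_simps)
    qed
  qed (use M x in simp)
  obtain k :: nat where k: "M < real k * \<kappa>"
    using \<kappa>(1) reals_Archimedean3 by blast
  have "E ((\<Phi> ^^ k) x) < \<eta>" if "x \<in> S" for x
    using drop[OF that, of k] nonneg[OF orbit[OF that, of k]] k by linarith
  then show ?thesis by blast
qed

lemma sum_cyclic_shift:
  fixes f :: "int \<Rightarrow> real"
  assumes "0 < N" "f N = f 0"
  shows "(\<Sum>i\<in>{0..<N}. f (i + 1)) = (\<Sum>i\<in>{0..<N}. f i)"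
proof -
  have "(\<Sum>i\<in>{0..<N}. f (i + 1)) = sum f {1..<N + 1}"
    by (rule sum.reindex_bij_witness[where i = "\<lambda>i. i - 1" and j = "\<lambda>i. i + 1"]) auto
  also have "{1..<N + 1} = insert N {1..<N}" using assms by auto
  also have "sum f \<dots> = f 0 + sum f {1..<N}" using assms by simp
  also have "\<dots> = sum f (insert 0 {1..<N})" by simp
  also have "insert 0 {1..<N} = {0..<N}" using assms by auto
  finally show ?thesis .
qed

lemma periodic_mod:
  fixes f :: "int \<Rightarrow> 'b"
  assumes "\<And>i. f (i + N) = f i"
  shows "f (i mod N) = f i"
proof -
  have up: "f (i + int k * N) = f i" for i k
  proof (induction k)
    case (Suc k)
    have "i + int (Suc k) * N = (i + int k * N) + N" by (simp add: algebra_simps)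
    then show ?case using assms[of "i + int k * N"] Suc by metis
  qed simp
  have "f (i + k * N) = f i" for k
  proof (cases "0 \<le> k")
    case True
    then show ?thesis using up[of i "nat k"] by simp
  next
    case False
    then show ?thesis using up[of "i + k * N" "nat (- k)"] by simp
  qed
  moreover have "i mod N = i + - (i div N) * N"
    by (simp add: minus_div_mult_eq_mod[symmetric])
  ultimately show ?thesis by metis
qed

section \<open>Length and distance along a path\<close>

lemma dist_le_sum_steps:
  fixes f :: "nat \<Rightarrow> 'a::metric_space"
  shows "dist (f 0) (f m) \<le> (\<Sum>i<m. dist (f i) (f (Suc i)))"
proof (induction m)
  case (Suc m)
  then show ?case
    using dist_triangle[of "f 0" "f (Suc m)" "f m"] by simp
qed simp

text \<open>
  A subdivision into equal steps shorter than \<open>\<delta>\<close> attains the value exactly. It also shows that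
  \<open>\<gamma>\<close> is \<open>c\<close>-Lipschitz on the whole interval, which bounds the sums of all other subdivisions.
\<close>
lemma path_length_of_local_isometry:
  fixes \<gamma> :: "real \<Rightarrow> 'a::metric_space"
  assumes "a \<le> b" "0 < \<delta>"
    and iso: "\<And>s t. \<lbrakk>a \<le> s; s \<le> t; t \<le> b; t - s < \<delta>\<rbrakk> \<Longrightarrow> dist (\<gamma> s) (\<gamma> t) = c * (t - s)"
  shows "path_length a b \<gamma> = ereal (c * (b - a))"
proof -
  have fine: "\<exists>m \<tau>. \<tau> 0 = s \<and> \<tau> m = t \<and> (\<forall>i<m. \<tau> i < \<tau> (Suc i)) \<and>
                (\<Sum>i<m. dist (\<gamma> (\<tau> i)) (\<gamma> (\<tau> (Suc i)))) = c * (t - s)"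
    if st: "a \<le> s" "s < t" "t \<le> b" for s t
  proof -
    define m where "m = nat \<lceil>(t - s) / \<delta>\<rceil> + 1"
    define h where "h = (t - s) / real m"
    define \<tau> where "\<tau> i = s + real i * h" for i
    have m: "0 < real m" "(t - s) / \<delta> < real m"
      unfolding m_def by linarith+
    have h: "0 < h" "h < \<delta>" "real m * h = t - s"
      using m st \<open>0 < \<delta>\<close> by (auto simp: h_def field_simps)
    have step: "dist (\<gamma> (\<tau> i)) (\<gamma> (\<tau> (Suc i))) = c * h" if "i < m" for i
    proof -
      have "real (Suc i) * h \<le> real m * h"
        using that h by (intro mult_right_mono) auto
      then have "\<tau> (Suc i) \<le> b"
        using h st by (simp add: \<tau>_def)
      moreover have "a \<le> \<tau> i"
        using st h by (simp add: \<tau>_def add_increasing2)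
      moreover have "\<tau> (Suc i) - \<tau> i = h"
        by (simp add: \<tau>_def algebra_simps)
      ultimately show ?thesis
        using iso[of "\<tau> i" "\<tau> (Suc i)"] h by simp
    qed
    have "(\<Sum>i<m. dist (\<gamma> (\<tau> i)) (\<gamma> (\<tau> (Suc i)))) = c * (real m * h)"
      using step by simp
    then have "(\<Sum>i<m. dist (\<gamma> (\<tau> i)) (\<gamma> (\<tau> (Suc i)))) = c * (t - s)"
      unfolding h(3) .
    moreover have "\<tau> 0 = s" "\<tau> m = t" "\<forall>i<m. \<tau> i < \<tau> (Suc i)"
      using h by (auto simp: \<tau>_def algebra_simps)
    ultimately show ?thesis by blast
  qed
  have lip: "dist (\<gamma> s) (\<gamma> t) \<le> c * (t - s)" if st: "a \<le> s" "s \<le> t" "t \<le> b" for s t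
  proof (cases "s = t")
    case False
    then have "s < t" using st by simp
    with fine[of s t] st obtain m \<tau> where "\<tau> 0 = s" "\<tau> m = t"
      "(\<Sum>i<m. dist (\<gamma> (\<tau> i)) (\<gamma> (\<tau> (Suc i)))) = c * (t - s)"
      by (metis (no_types, lifting))
    then show ?thesis
      using dist_le_sum_steps[of "\<gamma> \<circ> \<tau>" m] by simp
  qed simp
  let ?A = "{ereal (\<Sum>i<m. dist (\<gamma> (t i)) (\<gamma> (t (Suc i)))) | (m::nat) (t::nat \<Rightarrow> real).
            t 0 = a \<and> t m = b \<and> (\<forall>i<m. t i < t (Suc i))}"
  have "ereal (c * (b - a)) \<in> ?A"
  proof (cases "a = b")
    case True
    then show ?thesis
      by (auto intro!: exI[of _ 0] exI[of _ "\<lambda>_. a"])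
  next
    case False
    then have "a < b" using assms by simp
    from fine[OF order_refl this order_refl] obtain m \<tau> where
      "\<tau> 0 = a \<and> \<tau> m = b \<and> (\<forall>i<m. \<tau> i < \<tau> (Suc i))"
      "(\<Sum>i<m. dist (\<gamma> (\<tau> i)) (\<gamma> (\<tau> (Suc i)))) = c * (b - a)"
      by (metis (no_types, lifting))
    then show ?thesis
      by (intro CollectI exI[of _ m] exI[of _ \<tau>]) simp
  qed
  moreover have "x \<le> ereal (c * (b - a))" if "x \<in> ?A" for x
  proof -
    from that obtain m \<tau> where x: "x = ereal (\<Sum>i<m. dist (\<gamma> (\<tau> i)) (\<gamma> (\<tau> (Suc i))))"
      and \<tau>: "\<tau> 0 = a" "\<tau> m = b" "\<forall>i<m. \<tau> i < \<tau> (Suc i)"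
      by blast
    have mono: "\<tau> i \<le> \<tau> j" if "i \<le> j" "j \<le> m" for i j
      using that
    proof (induction j rule: dec_induct)
      case (step k)
      then show ?case
        using \<tau>(3) by (meson Suc_leD Suc_le_lessD less_imp_le order_trans)
    qed simp
    have "(\<Sum>i<m. dist (\<gamma> (\<tau> i)) (\<gamma> (\<tau> (Suc i)))) \<le> (\<Sum>i<m. c * (\<tau> (Suc i) - \<tau> i))"
    proof (intro sum_mono lip)
      fix i assume i: "i \<in> {..<m}"
      show "a \<le> \<tau> i" "\<tau> i \<le> \<tau> (Suc i)" "\<tau> (Suc i) \<le> b"
        using mono[of 0 i] mono[of i "Suc i"] mono[of "Suc i" m] i \<tau> by auto
    qed
    also have "\<dots> = c * (b - a)"
      using \<tau> by (simp add: sum_distrib_left[symmetric] sum_lessThan_telescope)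
    finally show ?thesis using x by simp
  qed
  ultimately show ?thesis
    unfolding path_length_def by (intro antisym Sup_least Sup_upper) auto
qed

lemma dist_le_path_length:
  assumes "a \<le> b"
  shows "ereal (dist (\<gamma> a) (\<gamma> b)) \<le> path_length a b \<gamma>"
proof (cases "a = b")
  case True
  then show ?thesis
    unfolding path_length_def
    by (intro Sup_upper) (auto intro!: exI[of _ 0] exI[of _ "\<lambda>_. a"])
next
  case False
  then show ?thesis
    using assms unfolding path_length_def
    by (intro Sup_upper)
       (auto intro!: exI[of _ "Suc 0"] exI[of _ "\<lambda>i. if i = 0 then a else b"])
qed

text \<open>
  A path that uses up its whole Lipschitz allowance between the end points has no slack on any
  subinterval. This is how concatenations are recognised as shortest paths below.
\<close>
lemma isometric_of_lipschitz_endpoints: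
  fixes \<gamma> :: "real \<Rightarrow> 'a::metric_space"
  assumes lip: "\<And>s t. \<lbrakk>a \<le> s; s \<le> t; t \<le> b\<rbrakk> \<Longrightarrow> dist (\<gamma> s) (\<gamma> t) \<le> c * (t - s)"
    and ends: "dist (\<gamma> a) (\<gamma> b) = c * (b - a)"
    and st: "a \<le> s" "s \<le> t" "t \<le> b"
  shows "dist (\<gamma> s) (\<gamma> t) = c * (t - s)"
proof -
  have "c * (b - a) \<le> dist (\<gamma> a) (\<gamma> s) + dist (\<gamma> s) (\<gamma> t) + dist (\<gamma> t) (\<gamma> b)"
    using ends dist_triangle[of "\<gamma> a" "\<gamma> b" "\<gamma> s"] dist_triangle[of "\<gamma> s" "\<gamma> b" "\<gamma> t"] by linarith
  moreover have "dist (\<gamma> a) (\<gamma> s) \<le> c * (s - a)" "dist (\<gamma> s) (\<gamma> t) \<le> c * (t - s)"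
    "dist (\<gamma> t) (\<gamma> b) \<le> c * (b - t)"
    using lip st by auto
  ultimately show ?thesis by (simp add: algebra_simps)
qed

lemma lipschitz_concat:
  fixes \<gamma> :: "real \<Rightarrow> 'a::metric_space"
  assumes "\<And>s t. \<lbrakk>a \<le> s; s \<le> t; t \<le> m\<rbrakk> \<Longrightarrow> dist (\<gamma> s) (\<gamma> t) \<le> c * (t - s)"
    and "\<And>s t. \<lbrakk>m \<le> s; s \<le> t; t \<le> b\<rbrakk> \<Longrightarrow> dist (\<gamma> s) (\<gamma> t) \<le> c * (t - s)"
    and st: "a \<le> s" "s \<le> t" "t \<le> b"
  shows "dist (\<gamma> s) (\<gamma> t) \<le> c * (t - s)"
proof (cases "s \<le> m \<and> m \<le> t")
  case True
  have "dist (\<gamma> s) (\<gamma> t) \<le> dist (\<gamma> s) (\<gamma> m) + dist (\<gamma> m) (\<gamma> t)"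
    by (rule dist_triangle)
  also have "\<dots> \<le> c * (m - s) + c * (t - m)"
    using True st assms(1)[of s m] assms(2)[of m t] by linarith
  finally show ?thesis by (simp add: algebra_simps)
next
  case False
  then show ?thesis using assms(1)[of s t] assms(2)[of s t] st by linarith
qed

lemma continuous_of_local_isometry:
  fixes \<gamma> :: "real \<Rightarrow> 'a::metric_space"
  assumes "0 < \<delta>" "0 \<le> c"
    and iso: "\<And>s t. \<lbrakk>s \<in> A; t \<in> A; s \<le> t; t - s < \<delta>\<rbrakk> \<Longrightarrow> dist (\<gamma> s) (\<gamma> t) = c * (t - s)"
  shows "continuous_on A \<gamma>"
  unfolding continuous_on_iff
proof (intro ballI allI impI)
  fix t e :: real assume "t \<in> A" "0 < e"
  have near: "dist (\<gamma> s) (\<gamma> t) < e" if "s \<in> A" "dist s t < min \<delta> (e / (c + 1))" for s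
  proof -
    have "dist (\<gamma> s) (\<gamma> t) = c * \<bar>s - t\<bar>"
    proof (cases "s \<le> t")
      case True
      then show ?thesis using that iso[of s t] \<open>t \<in> A\<close> by (simp add: dist_real_def)
    next
      case False
      then show ?thesis using that iso[of t s] \<open>t \<in> A\<close>
        by (simp add: dist_real_def dist_commute)
    qed
    also have "\<dots> \<le> (c + 1) * \<bar>s - t\<bar>"
      by (intro mult_right_mono) auto
    also have "\<dots> < e"
      using that \<open>0 \<le> c\<close> by (simp add: dist_real_def field_simps)
    finally show ?thesis .
  qed
  show "\<exists>d>0. \<forall>s\<in>A. dist s t < d \<longrightarrow> dist (\<gamma> s) (\<gamma> t) < e"
    by (rule exI[of _ "min \<delta> (e / (c + 1))"]) (use assms near \<open>0 < e\<close> in auto)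
qed

section \<open>Unique shortest paths as a betweenness property\<close>

lemma normalized_shortest_path_dist:
  assumes "normalized_shortest_path X x y \<gamma>" "0 \<le> s" "s \<le> t" "t \<le> 1"
  shows "dist (\<gamma> s) (\<gamma> t) = dist x y * (t - s)"
proof -
  from assms obtain c where
    c: "\<And>s t. \<lbrakk>s \<in> {0..1}; t \<in> {0..1}; s \<le> t\<rbrakk> \<Longrightarrow> path_length s t \<gamma> = ereal (c * (t - s))"
    and e: "ereal (dist (\<gamma> 0) (\<gamma> 1)) = path_length 0 1 \<gamma>" "\<gamma> 0 = x" "\<gamma> 1 = y"
    by (auto simp: normalized_shortest_path_def arclength_proportional_on_def shortest_path_def)
  have [simp]: "c = dist x y"
    using e c[of 0 1] by simp
  show ?thesis
  proof (rule isometric_of_lipschitz_endpoints[of 0 1])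
    fix s t :: real assume "0 \<le> s" "s \<le> t" "t \<le> 1"
    then show "dist (\<gamma> s) (\<gamma> t) \<le> dist x y * (t - s)"
      using dist_le_path_length[of s t \<gamma>] c[of s t] by simp
  qed (use assms e in auto)
qed

lemma normalized_shortest_path_of_isometry:
  assumes iso: "\<And>s t. \<lbrakk>0 \<le> s; s \<le> t; t \<le> 1\<rbrakk> \<Longrightarrow> dist (\<gamma> s) (\<gamma> t) = dist x y * (t - s)"
    and "\<gamma> 0 = x" "\<gamma> 1 = y" "\<gamma> ` {0..1} \<subseteq> X"
  shows "normalized_shortest_path X x y \<gamma>"
proof -
  have len: "path_length s t \<gamma> = ereal (dist x y * (t - s))" if "0 \<le> s" "s \<le> t" "t \<le> 1" for s t
    by (rule path_length_of_local_isometry[where \<delta> = 1]) (use that iso in auto)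
  have "continuous_on {0..1} \<gamma>"
    by (rule continuous_of_local_isometry[of 1 "dist x y"]) (auto intro: iso)
  then show ?thesis
    using assms len[of 0 1] len
    unfolding normalized_shortest_path_def shortest_path_def arclength_proportional_on_def
    by auto
qed

text \<open>
  Since \<open>w\<close> divides the distance exactly, the concatenation of shortest paths from \<open>x\<close> to \<open>w\<close> and
  from \<open>w\<close> to \<open>y\<close> loses nothing at \<open>w\<close>.
\<close>
lemma normalized_shortest_path_through:
  assumes p: "normalized_shortest_path X x w \<gamma>1" and q: "normalized_shortest_path X w y \<gamma>2"
    and t: "0 < t" "t < 1" and d: "dist x w = t * dist x y" "dist w y = (1 - t) * dist x y"
  shows "\<exists>\<gamma>. normalized_shortest_path X x y \<gamma> \<and> \<gamma> t = w"
proof -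
  define \<gamma> where "\<gamma> s = (if s \<le> t then \<gamma>1 (s / t) else \<gamma>2 ((s - t) / (1 - t)))" for s
  have ends: "\<gamma>1 0 = x" "\<gamma>1 1 = w" "\<gamma>2 0 = w" "\<gamma>2 1 = y"
    using p q by (auto simp: normalized_shortest_path_def)
  have \<gamma>2: "\<gamma> s = \<gamma>2 ((s - t) / (1 - t))" if "t \<le> s" for s
    using that t ends by (auto simp: \<gamma>_def)
  have lip: "dist (\<gamma> r) (\<gamma> s) \<le> dist x y * (s - r)" if rs: "0 \<le> r" "r \<le> s" "s \<le> 1" for r s
  proof (rule lipschitz_concat[where a = 0 and m = t and b = 1 and \<gamma> = \<gamma>])
    fix r s assume rs: "0 \<le> r" "r \<le> s" "s \<le> t"
    have "0 \<le> r / t" "r / t \<le> s / t" "s / t \<le> 1"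
      using rs t divide_right_mono[of r s t] by simp_all
    from normalized_shortest_path_dist[OF p this]
    have "dist (\<gamma> r) (\<gamma> s) = t * dist x y * (s / t - r / t)"
      using rs d by (simp add: \<gamma>_def)
    also have "\<dots> = dist x y * (s - r)"
      using t by (simp add: right_diff_distrib)
    finally show "dist (\<gamma> r) (\<gamma> s) \<le> dist x y * (s - r)" by simp
  next
    fix r s assume rs: "t \<le> r" "r \<le> s" "s \<le> 1"
    have "0 \<le> (r - t) / (1 - t)" "(r - t) / (1 - t) \<le> (s - t) / (1 - t)" "(s - t) / (1 - t) \<le> 1"
      using rs t divide_right_mono[of "r - t" "s - t" "1 - t"] by simp_all
    from normalized_shortest_path_dist[OF q this]
    have "dist (\<gamma> r) (\<gamma> s) = (1 - t) * dist x y * ((s - t) / (1 - t) - (r - t) / (1 - t))"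
      using rs d by (simp add: \<gamma>2)
    also have "\<dots> = dist x y * (s - r)"
      using t by (simp add: diff_divide_distrib[symmetric])
    finally show "dist (\<gamma> r) (\<gamma> s) \<le> dist x y * (s - r)" by simp
  qed (fact rs)+
  have at: "\<gamma> 0 = x" "\<gamma> 1 = y" "\<gamma> t = w"
    using t ends \<gamma>2[of 1] by (auto simp: \<gamma>_def)
  then have "dist (\<gamma> 0) (\<gamma> 1) = dist x y * (1 - 0)" by simp
  note iso = isometric_of_lipschitz_endpoints[where \<gamma> = \<gamma>, OF lip this]
  have "\<gamma> ` {0..1} \<subseteq> X"
  proof (clarify)
    fix s :: real assume s: "s \<in> {0..1}"
    have "\<gamma>1 ` {0..1} \<subseteq> X" "\<gamma>2 ` {0..1} \<subseteq> X"
      using p q by (auto simp: normalized_shortest_path_def shortest_path_def)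
    moreover have "s \<le> t \<Longrightarrow> s / t \<in> {0..1}" "t < s \<Longrightarrow> (s - t) / (1 - t) \<in> {0..1}"
      using s t by auto
    ultimately show "\<gamma> s \<in> X"
      unfolding \<gamma>_def by (simp add: image_subset_iff)
  qed
  then have "normalized_shortest_path X x y \<gamma>"
    using iso at by (intro normalized_shortest_path_of_isometry)
  then show ?thesis using at by auto
qed

text \<open>
  Uniqueness of short paths becomes uniqueness of points: a second point dividing the distance in
  the same ratio would lie on a second shortest path. The arguments about deformations use only
  this property, in which no path occurs.
\<close>
lemma locally_uniquely_geodesic_between:
  assumes "locally_uniquely_geodesic X"
  shows "\<exists>\<epsilon>>0. \<forall>x\<in>X. \<forall>y\<in>X. \<forall>t\<in>{0..1}. dist x y \<le> \<epsilon> \<longrightarrow>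
    (\<exists>!w. w \<in> X \<and> dist x w = t * dist x y \<and> dist w y = (1 - t) * dist x y)"
proof -
  from assms obtain \<epsilon> where "0 < \<epsilon>" and
    ex: "\<And>x y. \<lbrakk>x \<in> X; y \<in> X; dist x y \<le> \<epsilon>\<rbrakk> \<Longrightarrow>
        (\<exists>\<gamma>. normalized_shortest_path X x y \<gamma> \<and>
             (\<forall>\<gamma>'. normalized_shortest_path X x y \<gamma>' \<longrightarrow> (\<forall>t\<in>{0..1}. \<gamma>' t = \<gamma> t)))"
    unfolding locally_uniquely_geodesic_def by metis
  have "\<exists>!w. w \<in> X \<and> dist x w = t * dist x y \<and> dist w y = (1 - t) * dist x y"
    if xy: "x \<in> X" "y \<in> X" "t \<in> {0..1}" "dist x y \<le> \<epsilon>" for x y t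
  proof -
    from ex xy obtain \<gamma> where \<gamma>: "normalized_shortest_path X x y \<gamma>"
      and uniq: "\<And>\<gamma>'. normalized_shortest_path X x y \<gamma>' \<Longrightarrow> (\<forall>t\<in>{0..1}. \<gamma>' t = \<gamma> t)"
      by blast
    show ?thesis
    proof (intro ex1I[of _ "\<gamma> t"] conjI)
      have e: "\<gamma> 0 = x" "\<gamma> 1 = y" and "\<gamma> ` {0..1} \<subseteq> X"
        using \<gamma> by (auto simp: normalized_shortest_path_def shortest_path_def)
      then show "\<gamma> t \<in> X" using xy by auto
      show "dist x (\<gamma> t) = t * dist x y" "dist (\<gamma> t) y = (1 - t) * dist x y"
        using normalized_shortest_path_dist[OF \<gamma>, of 0 t]
          normalized_shortest_path_dist[OF \<gamma>, of t 1] xy e by auto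
    next
      fix w assume w: "w \<in> X \<and> dist x w = t * dist x y \<and> dist w y = (1 - t) * dist x y"
      have e: "\<gamma> 0 = x" "\<gamma> 1 = y"
        using \<gamma> by (auto simp: normalized_shortest_path_def)
      consider "t = 0" | "t = 1" | "0 < t" "t < 1" using xy by fastforce
      then show "w = \<gamma> t"
      proof cases
        case 3
        have "t * dist x y \<le> \<epsilon>" "(1 - t) * dist x y \<le> \<epsilon>"
          using xy mult_right_mono[of t 1 "dist x y"] mult_right_mono[of "1 - t" 1 "dist x y"]
          by auto
        with w xy ex[of x w] ex[of w y] obtain \<gamma>1 \<gamma>2 where
          "normalized_shortest_path X x w \<gamma>1" "normalized_shortest_path X w y \<gamma>2"
          by metis
        with normalized_shortest_path_through[OF this 3] w obtain \<gamma>' where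
          "normalized_shortest_path X x y \<gamma>'" "\<gamma>' t = w" by blast
        with uniq xy show ?thesis by blast
      qed (use w e in auto)
    qed
  qed
  with \<open>0 < \<epsilon>\<close> show ?thesis by blast
qed

text \<open>
  The point \<open>w\<close> is the one at time \<open>t\<close> on the unique shortest path from \<open>x\<close> to \<open>y\<close>.
\<close>
locale unique_betweenness =
  fixes X :: "'a::metric_space set" and \<epsilon> :: real
  assumes compact_X: "compact X" and eps_pos: "0 < \<epsilon>"
    and between: "\<lbrakk>x \<in> X; y \<in> X; dist x y \<le> \<epsilon>; 0 \<le> t; t \<le> 1\<rbrakk> \<Longrightarrow>
      \<exists>!w. w \<in> X \<and> dist x w = t * dist x y \<and> dist w y = (1 - t) * dist x y"
begin

definition geod :: "'a \<Rightarrow> 'a \<Rightarrow> real \<Rightarrow> 'a" where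
  "geod x y t = (THE w. w \<in> X \<and> dist x w = t * dist x y \<and> dist w y = (1 - t) * dist x y)"

lemma
  assumes "x \<in> X" "y \<in> X" "dist x y \<le> \<epsilon>" "0 \<le> t" "t \<le> 1"
  shows geod_in: "geod x y t \<in> X"
    and dist_geod_left: "dist x (geod x y t) = t * dist x y"
    and dist_geod_right: "dist (geod x y t) y = (1 - t) * dist x y"
  using theI'[OF between[OF assms]] unfolding geod_def by auto

lemma geod_unique:
  assumes "x \<in> X" "y \<in> X" "dist x y \<le> \<epsilon>" "0 \<le> t" "t \<le> 1"
    and "w \<in> X" "dist x w = t * dist x y" "dist w y = (1 - t) * dist x y"
  shows "geod x y t = w"
  unfolding geod_def using assms by (intro the1_equality between) auto

lemma geod_0: "\<lbrakk>x \<in> X; y \<in> X; dist x y \<le> \<epsilon>\<rbrakk> \<Longrightarrow> geod x y 0 = x"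
  and geod_1: "\<lbrakk>x \<in> X; y \<in> X; dist x y \<le> \<epsilon>\<rbrakk> \<Longrightarrow> geod x y 1 = y"
  by (rule geod_unique; simp)+

lemma geod_const: "\<lbrakk>x \<in> X; 0 \<le> t; t \<le> 1\<rbrakk> \<Longrightarrow> geod x x t = x"
  using eps_pos by (intro geod_unique) auto

text \<open>
  Go from \<open>x\<close> towards the point \<open>w\<close> at time \<open>t\<close>: the point \<open>v\<close> reached there at time \<open>s / t\<close> has the
  distances that characterise the point at time \<open>s\<close> between \<open>x\<close> and \<open>y\<close>, so it is that point.
\<close>
lemma dist_geod:
  assumes xy: "x \<in> X" "y \<in> X" "dist x y \<le> \<epsilon>" and st: "0 \<le> s" "s \<le> t" "t \<le> 1"
  shows "dist (geod x y s) (geod x y t) = dist x y * (t - s)"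
proof (cases "t = 0")
  case False
  then have t: "0 < t" using st by simp
  define w where "w = geod x y t"
  define v where "v = geod x w (s / t)"
  have w: "w \<in> X" "dist x w = t * dist x y" "dist w y = (1 - t) * dist x y"
    using geod_in dist_geod_left dist_geod_right xy st unfolding w_def by auto
  have "dist x w \<le> \<epsilon>"
    using w xy st mult_right_mono[of t 1 "dist x y"] by simp
  moreover have "0 \<le> s / t" "s / t \<le> 1"
    using st t by auto
  ultimately have v: "v \<in> X" "dist x v = s / t * dist x w" "dist v w = (1 - s / t) * dist x w"
    using geod_in dist_geod_left dist_geod_right xy w unfolding v_def by auto
  have d: "dist x v = s * dist x y" "dist v w = (t - s) * dist x y"
    using v w t by (simp_all add: left_diff_distrib)
  have "dist v y = (1 - s) * dist x y"
    using dist_triangle[of v y w] dist_triangle[of x y v] d w by (simp add: algebra_simps)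
  then have "geod x y s = v"
    using xy st v d by (intro geod_unique) auto
  then show ?thesis
    using d w_def by (simp add: mult.commute)
qed (use st in auto)

text \<open>
  The graph of \<open>geod\<close> is cut out by two equations between continuous functions, and its values lie
  in a compact set.
\<close>
lemma continuous_geod:
  "continuous_on {(x, y, t). x \<in> X \<and> y \<in> X \<and> dist x y \<le> \<epsilon> \<and> 0 \<le> t \<and> t \<le> 1}
     (\<lambda>(x, y, t). geod x y t)" (is "continuous_on ?D ?g")
proof (rule continuous_on_of_closed_graph[OF compact_X])
  show "?g \<in> ?D \<rightarrow> X"
    using geod_in by auto
  let ?E = "?D \<times> X"
  let ?F = "\<lambda>q. \<bar>dist (fst (fst q)) (snd q) - snd (snd (fst q)) * dist (fst (fst q)) (fst (snd (fst q)))\<bar> +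
              \<bar>dist (snd q) (fst (snd (fst q))) - (1 - snd (snd (fst q))) * dist (fst (fst q)) (fst (snd (fst q)))\<bar>"
  have "continuous_on ?E ?F"
    by (intro continuous_intros)
  then have "closedin (top_of_set ?E) (?E \<inter> ?F -` {0})"
    by (intro continuous_closedin_preimage) auto
  also have "?E \<inter> ?F -` {0} = (\<lambda>q. (q, ?g q)) ` ?D"
  proof (intro equalityI subsetI)
    fix q assume q: "q \<in> ?E \<inter> ?F -` {0}"
    obtain x y t w where [simp]: "q = ((x, y, t), w)" by (metis surj_pair)
    from q have "geod x y t = w"
      by (intro geod_unique) (auto simp: abs_if split: if_splits)
    then show "q \<in> (\<lambda>q. (q, ?g q)) ` ?D"
      using q by force
  qed (use geod_in dist_geod_left dist_geod_right in auto)
  finally show "closedin (top_of_set ?E) ((\<lambda>q. (q, ?g q)) ` ?D)" .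
qed

lemma continuous_on_geod:
  assumes "continuous_on S a" "continuous_on S b" "continuous_on S r"
    and "\<And>q. q \<in> S \<Longrightarrow> a q \<in> X" "\<And>q. q \<in> S \<Longrightarrow> b q \<in> X" "\<And>q. q \<in> S \<Longrightarrow> dist (a q) (b q) \<le> \<epsilon>"
    and "\<And>q. q \<in> S \<Longrightarrow> 0 \<le> r q" "\<And>q. q \<in> S \<Longrightarrow> r q \<le> 1"
  shows "continuous_on S (\<lambda>q. geod (a q) (b q) (r q))"
proof -
  have "continuous_on S ((\<lambda>(x, y, t). geod x y t) \<circ> (\<lambda>q. (a q, b q, r q)))"
    using assms
    by (intro continuous_on_compose continuous_on_Pair continuous_on_subset[OF continuous_geod]) auto
  then show ?thesis by (simp add: o_def)
qed

section \<open>Closed polygons\<close>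

text \<open>
  Vertices are indexed periodically by all integers, so that neither the successor of a vertex nor
  a cyclic shift needs a case distinction at the last vertex. In the topology of pointwise
  convergence the polygons form a closed subset of a product of copies of \<open>X\<close>.
\<close>
definition polygons :: "int \<Rightarrow> (int \<Rightarrow> 'a) set" where
  "polygons N = {z. \<forall>i. z i \<in> X \<and> z (i + N) = z i \<and> dist (z i) (z (i + 1)) \<le> \<epsilon>}"

lemma polygonsD:
  assumes "z \<in> polygons N"
  shows "z i \<in> X" "z (i + N) = z i" "dist (z i) (z (i + 1)) \<le> \<epsilon>"
  using assms by (auto simp: polygons_def)

lemma const_polygon: "x \<in> X \<Longrightarrow> (\<lambda>_. x) \<in> polygons N"
  using eps_pos by (simp add: polygons_def)

lemma continuous_on_vertex:
  "continuous_on S f \<Longrightarrow> continuous_on S (\<lambda>q. (f q :: int \<Rightarrow> 'a) i)"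
  by (rule continuous_on_product_then_coordinatewise)

lemma compact_polygons: "compact (polygons N)"
proof -
  have "compactin (product_topology (\<lambda>_::int. euclidean) UNIV) (PiE UNIV (\<lambda>_. X))"
    unfolding compactin_PiE using compact_X by simp
  then have "compact (PiE UNIV (\<lambda>_::int. X))"
    by (simp add: euclidean_product_topology)
  moreover have "closed {z :: int \<Rightarrow> 'a. \<forall>i. z (i + N) = z i \<and> dist (z i) (z (i + 1)) \<le> \<epsilon>}"
    by (intro closed_Collect_all closed_Collect_conj closed_Collect_eq closed_Collect_le
        continuous_on_vertex continuous_on_dist continuous_on_const continuous_on_id)
  ultimately have "compact (PiE UNIV (\<lambda>_::int. X) \<inter>
      {z. \<forall>i. z (i + N) = z i \<and> dist (z i) (z (i + 1)) \<le> \<epsilon>})"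
    by (rule compact_Int_closed)
  also have "\<dots> = polygons N"
    by (auto simp: polygons_def PiE_UNIV_domain)
  finally show ?thesis .
qed

text \<open>
  Every vertex moves along the edge that follows it, for the proportion \<open>s\<close> of that edge. For
  \<open>s = 1/2\<close> the result is the polygon of midpoints, which is one step of a Birkhoff shortening
  process, and the smaller values of \<open>s\<close> connect that step to the identity.
\<close>
definition slide :: "real \<Rightarrow> (int \<Rightarrow> 'a) \<Rightarrow> int \<Rightarrow> 'a" where
  "slide s z i = geod (z i) (z (i + 1)) s"

text \<open>
  Cut the corner at the old vertex \<open>z (i + 1)\<close>. The bound is a convex combination of two edge
  lengths, which is why sliding does not lead out of the set of polygons.
\<close>
lemma dist_slide_le:
  assumes z: "z \<in> polygons N" and s: "0 \<le> s" "s \<le> 1"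
  shows "dist (slide s z i) (slide s z (i + 1))
    \<le> (1 - s) * dist (z i) (z (i + 1)) + s * dist (z (i + 1)) (z (i + 1 + 1))"
proof -
  have "dist (slide s z i) (slide s z (i + 1))
      \<le> dist (slide s z i) (z (i + 1)) + dist (z (i + 1)) (slide s z (i + 1))"
    by (rule dist_triangle)
  also have "dist (slide s z i) (z (i + 1)) = (1 - s) * dist (z i) (z (i + 1))"
    unfolding slide_def by (intro dist_geod_right polygonsD[OF z] s)
  also have "dist (z (i + 1)) (slide s z (i + 1)) = s * dist (z (i + 1)) (z (i + 1 + 1))"
    unfolding slide_def by (intro dist_geod_left polygonsD[OF z] s)
  finally show ?thesis .
qed

lemma slide_polygon:
  assumes z: "z \<in> polygons N" and s: "0 \<le> s" "s \<le> 1"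
  shows "slide s z \<in> polygons N"
proof -
  have "slide s z i \<in> X" for i
    unfolding slide_def by (intro geod_in polygonsD[OF z] s)
  moreover have "slide s z (i + N) = slide s z i" for i
    using polygonsD(2)[OF z, of i] polygonsD(2)[OF z, of "i + 1"] by (simp add: slide_def ac_simps)
  moreover have "dist (slide s z i) (slide s z (i + 1)) \<le> \<epsilon>" for i
    by (rule order_trans[OF dist_slide_le[OF z s] convex_bound_le])
       (use s polygonsD(3)[OF z, of i] polygonsD(3)[OF z, of "i + 1"] in simp_all)
  ultimately show ?thesis by (simp add: polygons_def)
qed

lemma continuous_slide:
  "continuous_on ({0..1} \<times> polygons N) (\<lambda>q. slide (fst q) (snd q))"
  unfolding slide_def
  by (rule continuous_on_coordinatewise_then_product,
      intro continuous_on_geod continuous_on_vertex continuous_on_fst continuous_on_snd continuous_on_id)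
     (auto simp: polygonsD)

text \<open>
  The closed path along the edges, with one unit of time for each edge.
\<close>
definition polypath :: "(int \<Rightarrow> 'a) \<Rightarrow> real \<Rightarrow> 'a" where
  "polypath z u = geod (z \<lfloor>u\<rfloor>) (z (\<lfloor>u\<rfloor> + 1)) (u - \<lfloor>u\<rfloor>)"

text \<open>
  At the right end point the floor has already moved on to the next edge, but both descriptions
  give the common vertex. On closed time intervals the path is thus given by a single edge.
\<close>
lemma polypath_segment:
  assumes z: "z \<in> polygons N" and u: "of_int i \<le> u" "u \<le> of_int i + 1"
  shows "polypath z u = geod (z i) (z (i + 1)) (u - of_int i)"
proof (cases "u = of_int i + 1")
  case True
  then have "\<lfloor>u\<rfloor> = i + 1" by linarith
  then show ?thesis
    using True polygonsD[OF z] polygonsD(3)[OF z, of "i + 1"]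
    by (simp add: polypath_def geod_0 geod_1)
next
  case False
  then have "\<lfloor>u\<rfloor> = i" using u by linarith
  then show ?thesis by (simp add: polypath_def)
qed

lemma polypath_vertex: "z \<in> polygons N \<Longrightarrow> polypath z (of_int i) = z i"
  by (subst polypath_segment[of _ _ i]) (auto simp: geod_0 polygonsD)

lemma polypath_in: "z \<in> polygons N \<Longrightarrow> polypath z u \<in> X"
  unfolding polypath_def 
  by (rule geod_in) (simp_all add: polygonsD, linarith)

lemma polypath_periodic: "z \<in> polygons N \<Longrightarrow> polypath z (u + of_int N) = polypath z u"
  using polygonsD(2)[of z N "\<lfloor>u\<rfloor>"] polygonsD(2)[of z N "\<lfloor>u\<rfloor> + 1"]
  by (simp add: polypath_def algebra_simps)

lemma polypath_const: "x \<in> X \<Longrightarrow> polypath (\<lambda>_. x) u = x"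
  unfolding polypath_def by (rule geod_const; linarith)

lemma polypath_midpoint: "z \<in> polygons N \<Longrightarrow> polypath z (of_int i + 1/2) = slide (1/2) z i"
  by (subst polypath_segment[of _ _ i]) (auto simp: slide_def)

lemma continuous_polypath:
  "continuous_on (polygons N \<times> {0..of_int N}) (\<lambda>q. polypath (fst q) (snd q))"
proof -
  let ?U = "\<lambda>i. polygons N \<times> {real_of_int i..of_int i + 1}"
  have "continuous_on (\<Union>i\<in>{0..N}. ?U i) (\<lambda>q. polypath (fst q) (snd q))"
  proof (rule continuous_on_closed_Union)
    show "closed (?U i)" for i
      using compact_imp_closed[OF compact_polygons] by (intro closed_Times) auto
    have "continuous_on (?U i)
        (\<lambda>q. geod (fst q i) (fst q (i + 1)) (snd q - of_int i))" for i
      by (intro continuous_on_geod continuous_on_vertex continuous_on_diff continuous_on_fst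
          continuous_on_snd continuous_on_const continuous_on_id) (auto simp: polygonsD)
    then show "continuous_on (?U i) (\<lambda>q. polypath (fst q) (snd q))" for i
      by (rule continuous_on_eq) (auto simp: polypath_segment)
  qed simp
  then show ?thesis
  proof (rule continuous_on_subset, clarify)
    fix z and u :: real assume "z \<in> polygons N" "u \<in> {0..of_int N}"
    then show "(z, u) \<in> (\<Union>i\<in>{0..N}. ?U i)"
      by (intro UN_I[of "\<lfloor>u\<rfloor>"]) (auto simp: le_floor_iff floor_le_iff; linarith)+
  qed
qed

text \<open>
  The path is \<open>c\<close>-Lipschitz. The two hypotheses say that it has no slack on the unit intervals that
  start at an integer (an edge) or halfway between two integers (from one midpoint to the next), so
  it is isometric up to the factor \<open>c\<close> on these intervals. Any two times less than \<open>1/2\<close> apart lie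
  in a common one.
\<close>
lemma periodic_geodesic_of_taut_polygon:
  assumes z: "z \<in> polygons N" and N: "0 < N" and c: "0 < c"
    and edge: "\<And>i. dist (z i) (z (i + 1)) = c"
    and mid: "\<And>i. dist (slide (1/2) z i) (slide (1/2) z (i + 1)) = c"
  shows "periodic_geodesic X (\<lambda>t. polypath z (of_int N * t))"
proof -
  have seg: "dist (polypath z u) (polypath z v) \<le> c * (v - u)"
    if "of_int i \<le> u" "u \<le> v" "v \<le> of_int i + 1" for i :: int and u v
    using that dist_geod[OF polygonsD(1,1,3)[OF z], of "u - of_int i" "v - of_int i" i] edge[of i]
    by (simp add: polypath_segment[OF z, of i])
  have iso: "dist (polypath z u) (polypath z v) = c * (v - u)" if uv: "u \<le> v" "v - u < 1/2" for u v
  proof -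
    define k where "k = \<lfloor>2 * u\<rfloor>"
    define i where "i = k div 2"
    have k: "of_int k \<le> 2 * u" "2 * u < of_int k + 1"
      unfolding k_def by linarith+
    consider "k = 2 * i" | "k = 2 * i + 1" unfolding i_def by linarith
    then show ?thesis
    proof cases
      case 1
      show ?thesis
      proof (rule isometric_of_lipschitz_endpoints[where \<gamma> = "polypath z" and a = "of_int i" and b = "of_int i + 1"])
        show "dist (polypath z (of_int i)) (polypath z (of_int i + 1)) = c * (of_int i + 1 - of_int i)"
          using polypath_vertex[OF z, of i] polypath_vertex[OF z, of "i + 1"] edge[of i] by simp
      qed (use 1 k uv seg in auto)
    next
      case 2
      show ?thesis
      proof (rule isometric_of_lipschitz_endpoints[where \<gamma> = "polypath z" and a = "of_int i + 1/2" and b = "of_int (i + 1) + 1/2"])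
        show "dist (polypath z (of_int i + 1/2)) (polypath z (of_int (i + 1) + 1/2))
            = c * (of_int (i + 1) + 1/2 - (of_int i + 1/2))"
          unfolding polypath_midpoint[OF z] mid by simp
        show "dist (polypath z r) (polypath z s) \<le> c * (s - r)"
          if "of_int i + 1/2 \<le> r" "r \<le> s" "s \<le> of_int (i + 1) + 1/2" for r s
        proof (rule lipschitz_concat[where \<gamma> = "polypath z" and a = "of_int i + 1/2" and m = "of_int (i + 1)" and b = "of_int (i + 1) + 1/2"])
          fix r s :: real
          show "of_int i + 1/2 \<le> r \<Longrightarrow> r \<le> s \<Longrightarrow> s \<le> of_int (i + 1) \<Longrightarrow>
            dist (polypath z r) (polypath z s) \<le> c * (s - r)"
            using seg[of i r s] by simp
          show "of_int (i + 1) \<le> r \<Longrightarrow> r \<le> s \<Longrightarrow> s \<le> of_int (i + 1) + 1/2 \<Longrightarrow>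
            dist (polypath z r) (polypath z s) \<le> c * (s - r)"
            using seg[of "i + 1" r s] by simp
        qed (use that in auto)
      qed (use 2 k uv in auto)
    qed
  qed
  define \<gamma> where "\<gamma> t = polypath z (of_int N * t)" for t
  define C \<delta> :: real where "C = c * of_int N" and "\<delta> = 1 / (2 * of_int N)"
  have pos: "0 < \<delta>" "0 < C" using N c by (auto simp: C_def \<delta>_def)
  have \<gamma>: "dist (\<gamma> s) (\<gamma> t) = C * (t - s)" if "s \<le> t" "t - s < \<delta>" for s t
  proof -
    have "of_int N * t - of_int N * s < 1/2"
      using that N by (simp add: \<delta>_def field_simps)
    then show ?thesis
      using iso[of "of_int N * s" "of_int N * t"] that N
      by (simp add: \<gamma>_def C_def algebra_simps)
  qed
  have len: "path_length s t \<gamma> = ereal (C * (t - s))" if "s \<le> t" for s t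
    by (rule path_length_of_local_isometry[OF that pos(1)]) (rule \<gamma>)
  have "periodic_geodesic X \<gamma>"
    unfolding periodic_geodesic_def
  proof (intro conjI)
    show "continuous_on UNIV \<gamma>"
      by (rule continuous_of_local_isometry[of \<delta> C]) (use pos \<gamma> in auto)
    show "range \<gamma> \<subseteq> X"
      using polypath_in[OF z] by (auto simp: \<gamma>_def)
    show "\<forall>t. \<gamma> (t + 1) = \<gamma> t"
      using polypath_periodic[OF z] by (simp add: \<gamma>_def distrib_left)
    show "\<exists>s t. \<gamma> s \<noteq> \<gamma> t"
      using \<gamma>[of 0 "\<delta> / 2"] pos by (intro exI[of _ 0] exI[of _ "\<delta> / 2"]) auto
    show "path_length 0 1 \<gamma> < \<infinity>"
      by (simp add: len)
    show "arclength_proportional_on UNIV \<gamma>"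
      unfolding arclength_proportional_on_def using len by blast
    show "\<exists>\<delta>>0. \<forall>s t. s \<le> t \<and> t - s < \<delta> \<longrightarrow> ereal (dist (\<gamma> s) (\<gamma> t)) = path_length s t \<gamma>"
      using pos len \<gamma> by (intro exI[of _ \<delta>]) auto
  qed
  then show ?thesis by (simp add: \<gamma>_def[abs_def])
qed

section \<open>Energy and midpoint shortening\<close>

definition energy :: "int \<Rightarrow> (int \<Rightarrow> 'a) \<Rightarrow> real" where
  "energy N z = (\<Sum>i\<in>{0..<N}. (dist (z i) (z (i + 1)))\<^sup>2)"

text \<open>
  Each square is split in half between its own index and the preceding one; then
  \<open>a\<^sup>2 / 2 + b\<^sup>2 / 2 = ((a + b) / 2)\<^sup>2 + ((a - b) / 2)\<^sup>2\<close>. The first summand bounds the square of an edge of the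
  midpoint polygon, the second one measures how unequal the edges are.
\<close>
lemma energy_decomposition:
  assumes z: "z \<in> polygons N" and N: "0 < N"
  defines "d \<equiv> \<lambda>i. dist (z i) (z (i + 1))"
  shows "energy N z = (\<Sum>i\<in>{0..<N}. ((d i + d (i + 1)) / 2)\<^sup>2 + ((d i - d (i + 1)) / 2)\<^sup>2)"
proof -
  have "d N = d 0"
    using polygonsD(2)[OF z, of 0] polygonsD(2)[OF z, of 1] by (simp add: d_def add.commute)
  then have "(\<Sum>i\<in>{0..<N}. (d (i + 1))\<^sup>2) = energy N z"
    using sum_cyclic_shift[OF N, of "\<lambda>i. (d i)\<^sup>2"] by (simp add: energy_def d_def)
  moreover have "((d i + d (i + 1)) / 2)\<^sup>2 + ((d i - d (i + 1)) / 2)\<^sup>2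
      = (d i)\<^sup>2 / 2 + (d (i + 1))\<^sup>2 / 2" for i
    by (simp add: power2_eq_square field_simps)
  moreover have "(\<Sum>i\<in>{0..<N}. (d i)\<^sup>2) = energy N z"
    by (simp add: energy_def d_def)
  ultimately show ?thesis
    by (simp add: sum.distrib flip: sum_divide_distrib)
qed

lemma shorten_edge_le:
  assumes "z \<in> polygons N"
  shows "(dist (slide (1/2) z i) (slide (1/2) z (i + 1)))\<^sup>2
    \<le> ((dist (z i) (z (i + 1)) + dist (z (i + 1)) (z (i + 1 + 1))) / 2)\<^sup>2"
  using dist_slide_le[OF assms, of "1/2" i] by (intro power_mono) (auto simp: field_simps)

lemma energy_shorten_le:
  assumes z: "z \<in> polygons N" and N: "0 < N"
  shows "energy N (slide (1/2) z) \<le> energy N z"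
  unfolding energy_decomposition[OF assms] energy_def[of N "slide (1/2) z"]
  by (intro sum_mono add_increasing2 shorten_edge_le[OF z] zero_le_power2)

text \<open>
  If the energy does not drop, then all edges have the same length and no corner is cut by the
  edges of the midpoint polygon. Such a polygon is a periodic geodesic unless it is constant.
\<close>
lemma energy_shorten_less:
  assumes none: "\<nexists>\<gamma>. periodic_geodesic X \<gamma>"
    and z: "z \<in> polygons N" and N: "0 < N" and pos: "0 < energy N z"
  shows "energy N (slide (1/2) z) < energy N z"
proof (rule ccontr)
  assume not: "\<not> energy N (slide (1/2) z) < energy N z"
  define d where "d i = dist (z i) (z (i + 1))" for i
  define e where "e i = dist (slide (1/2) z i) (slide (1/2) z (i + 1))" for i
  \<comment> \<open>\<open>b i\<close> is the contribution of index \<open>i\<close> to the loss of energy; it consists of a loss at the corner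
    and a loss from unequal edges, neither of which is negative.\<close>
  define b where "b i = (((d i + d (i + 1)) / 2)\<^sup>2 - (e i)\<^sup>2) + ((d i - d (i + 1)) / 2)\<^sup>2" for i
  have "sum b {0..<N} = energy N z - energy N (slide (1/2) z)"
    unfolding energy_decomposition[OF z N] energy_def[of N "slide (1/2) z"]
    by (simp add: b_def d_def e_def sum.distrib sum_subtractf)
  then have "sum b {0..<N} \<le> 0" using not by simp
  moreover have terms: "0 \<le> ((d i + d (i + 1)) / 2)\<^sup>2 - (e i)\<^sup>2" "0 \<le> ((d i - d (i + 1)) / 2)\<^sup>2" for i
    using shorten_edge_le[OF z, of i] by (auto simp: d_def e_def)
  then have b_nonneg: "0 \<le> b i" for i
    unfolding b_def by (meson add_nonneg_nonneg)
  ultimately have "sum b {0..<N} = 0"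
    using sum_nonneg[of "{0..<N}" b] by force
  then have b0: "b i = 0" if "i \<in> {0..<N}" for i
    using sum_nonneg_eq_0_iff[of "{0..<N}" b] b_nonneg that by auto
  have small: "d (i + 1) = d i \<and> e i = d i" if "i \<in> {0..<N}" for i
  proof -
    have "((d i - d (i + 1)) / 2)\<^sup>2 = 0" "((d i + d (i + 1)) / 2)\<^sup>2 = (e i)\<^sup>2"
      using b0[OF that] terms[of i] unfolding b_def by linarith+
    moreover have "0 \<le> e i" "0 \<le> d i" by (auto simp: d_def e_def)
    ultimately show ?thesis by (auto simp: power2_eq_iff)
  qed
  have per: "z (i + N) = z i" "z (i + N + 1) = z (i + 1)" "z (i + N + 1 + 1) = z (i + 1 + 1)" for i
    using polygonsD(2)[OF z, of i] polygonsD(2)[OF z, of "i + 1"] polygonsD(2)[OF z, of "i + 1 + 1"]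
    by (simp_all add: ac_simps)
  have "(d (i + N + 1) = d (i + N) \<and> e (i + N) = d (i + N)) = (d (i + 1) = d i \<and> e i = d i)" for i
    unfolding d_def e_def slide_def per ..
  from periodic_mod[of "\<lambda>i. d (i + 1) = d i \<and> e i = d i", OF this]
  have all: "d (i + 1) = d i" "e i = d i" for i
    using small[of "i mod N"] N by auto
  have const: "d i = d 0" for i
  proof (induction i rule: int_induct[of _ 0])
    case (step2 i)
    then show ?case using all(1)[of "i - 1"] by simp
  qed (use all in auto)
  have "d 0 \<noteq> 0"
  proof
    assume "d 0 = 0"
    then have "energy N z = 0"
      using const by (simp add: energy_def flip: d_def)
    then show False using pos by simp
  qed
  then have "0 < d 0" by (simp add: d_def)
  then have "periodic_geodesic X (\<lambda>t. polypath z (of_int N * t))"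
    using const all by (intro periodic_geodesic_of_taut_polygon[OF z N]) (auto simp flip: d_def e_def)
  then show False using none by blast
qed

lemma dist_le_of_energy:
  assumes z: "z \<in> polygons N" and N: "0 < N" and E: "energy N z < r\<^sup>2" and r: "0 < r"
  shows "dist (z i) (z 0) \<le> of_int N * r"
proof -
  have edge: "dist (z i) (z (i + 1)) \<le> r" if "i \<in> {0..<N}" for i
  proof -
    have "(dist (z i) (z (i + 1)))\<^sup>2 \<le> energy N z"
      unfolding energy_def using that by (intro member_le_sum) auto
    then have "(dist (z i) (z (i + 1)))\<^sup>2 \<le> r\<^sup>2"
      using E by linarith
    then show ?thesis
      by (rule power2_le_imp_le) (use r in linarith)
  qed
  have chain: "dist (z (int k)) (z 0) \<le> real k * r" if "int k < N" for k
    using that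
  proof (induction k)
    case (Suc k)
    have "dist (z (int k + 1)) (z 0) \<le> dist (z (int k)) (z (int k + 1)) + dist (z (int k)) (z 0)"
      by (metis dist_commute dist_triangle)
    then show ?case
      using Suc edge[of "int k"] by (simp add: algebra_simps)
  qed simp
  have mod: "0 \<le> i mod N" "i mod N < N" using N by auto
  have "dist (z (i mod N)) (z 0) \<le> real (nat (i mod N)) * r"
    using chain[of "nat (i mod N)"] N by simp
  also have "\<dots> \<le> of_int N * r"
    using mod r by (intro mult_right_mono) linarith+
  finally show ?thesis
    using periodic_mod[of z N i] polygonsD(2)[OF z] by simp
qed

lemma continuous_energy: "continuous_on S (energy N)"
  unfolding energy_def
  by (intro continuous_on_sum continuous_on_power continuous_on_dist continuous_on_vertex continuous_on_id)

section \<open>Deforming polygons to constant ones\<close>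

text \<open>
  A loop that is constant because its parameter lies on the boundary of the cube has to remain at
  the base point of the homotopy group.
\<close>
abbreviation fixes_constants :: "((int \<Rightarrow> 'a) \<Rightarrow> int \<Rightarrow> 'a) \<Rightarrow> bool" where
  "fixes_constants h \<equiv> \<forall>x\<in>X. h (\<lambda>_. x) = (\<lambda>_. x)"

text \<open>
  A homotopy only has to be specified on polygons; the constant ones, where it is required to be
  stationary, are among them.
\<close>
lemma homotopic_polygonsI:
  fixes h :: "real \<Rightarrow> (int \<Rightarrow> 'a) \<Rightarrow> int \<Rightarrow> 'a"
  assumes cont: "continuous_on ({0..1} \<times> polygons N) (\<lambda>q. h (fst q) (snd q))"
    and maps: "\<And>t z. \<lbrakk>0 \<le> t; t \<le> 1; z \<in> polygons N\<rbrakk> \<Longrightarrow> h t z \<in> polygons N"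
    and "\<And>z. z \<in> polygons N \<Longrightarrow> h 0 z = f z" "\<And>z. z \<in> polygons N \<Longrightarrow> h 1 z = g z"
    and "\<And>t. \<lbrakk>0 \<le> t; t \<le> 1\<rbrakk> \<Longrightarrow> fixes_constants (h t)"
  shows "homotopic_with_canon fixes_constants (polygons N) (polygons N) f g"
proof (subst homotopic_with)
  show "\<exists>h. continuous_map (prod_topology (top_of_set {0..1::real}) (top_of_set (polygons N)))
            (top_of_set (polygons N)) h \<and>
          (\<forall>x\<in>topspace (top_of_set (polygons N)). h (0, x) = f x) \<and>
          (\<forall>x\<in>topspace (top_of_set (polygons N)). h (1, x) = g x) \<and>
          (\<forall>t\<in>{0..1}. fixes_constants (\<lambda>x. h (t, x)))"
    using assms by (intro exI[of _ "\<lambda>q. h (fst q) (snd q)"]) auto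
qed (use const_polygon in \<open>metis topspace_euclidean_subtopology\<close>)

lemma homotopic_shorten:
  "homotopic_with_canon fixes_constants (polygons N) (polygons N) id (slide (1/2))"
proof (rule homotopic_polygonsI[where h = "\<lambda>t. slide (t / 2)"])
  have "continuous_on ({0..1} \<times> polygons N) ((\<lambda>q. slide (fst q) (snd q)) \<circ> (\<lambda>q. (fst q / 2, snd q)))"
    by (intro continuous_on_compose continuous_on_subset[OF continuous_slide, of _ N] continuous_on_Pair
        continuous_on_divide continuous_on_fst continuous_on_snd continuous_on_const continuous_on_id) auto
  then show "continuous_on ({0..1} \<times> polygons N) (\<lambda>q. slide (fst q / 2) (snd q))"
    by (simp add: o_def)
  show "fixes_constants (slide (t / 2))" if "0 \<le> t" "t \<le> 1" for t
    using that by (auto simp: slide_def geod_const)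
qed (auto simp: slide_polygon slide_def geod_0 polygonsD)

lemma homotopic_shorten_iterate:
  "homotopic_with_canon fixes_constants (polygons N) (polygons N) id (slide (1/2) ^^ k)"
proof (induction k)
  case (Suc k)
  have "homotopic_with_canon fixes_constants (polygons N) (polygons N)
      (id \<circ> slide (1/2) ^^ k) (slide (1/2) \<circ> slide (1/2) ^^ k)"
  proof (rule homotopic_with_compose_continuous_map_right[OF homotopic_shorten])
    show "continuous_map (top_of_set (polygons N)) (top_of_set (polygons N)) (slide (1/2) ^^ k)"
      using homotopic_with_imp_continuous_maps[OF Suc] by blast
    show "fixes_constants (j \<circ> slide (1/2) ^^ k)" if "fixes_constants j" for j
      using homotopic_with_imp_property[OF Suc] that by simp
  qed
  then show ?case
    unfolding funpow.simps id_comp by (rule homotopic_with_trans[OF Suc])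
qed simp

text \<open>
  All vertices run along shortest paths to the vertex with index \<open>0\<close>. They stay within \<open>\<epsilon> / 2\<close> of it,
  so consecutive vertices remain within \<open>\<epsilon>\<close> of each other.
\<close>
lemma homotopic_to_basepoint:
  assumes cont: "continuous_on (polygons N) \<Psi>" and maps: "\<Psi> \<in> polygons N \<rightarrow> polygons N"
    and consts_fixed: "fixes_constants \<Psi>"
    and small: "\<And>z i. z \<in> polygons N \<Longrightarrow> dist (\<Psi> z i) (\<Psi> z 0) \<le> \<epsilon> / 2"
  shows "homotopic_with_canon fixes_constants (polygons N) (polygons N) \<Psi> (\<lambda>z _. \<Psi> z 0)"
proof (rule homotopic_polygonsI[where h = "\<lambda>t z i. geod (\<Psi> z i) (\<Psi> z 0) t"])
  have \<Psi>: "\<Psi> z i \<in> X" "\<Psi> z (i + N) = \<Psi> z i" if "z \<in> polygons N" for z i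
    using maps that polygonsD by blast+
  have close: "dist (\<Psi> z i) (\<Psi> z 0) \<le> \<epsilon>" if "z \<in> polygons N" for z i
    using small[OF that, of i] eps_pos by linarith
  have c: "continuous_on ({0..1} \<times> polygons N) (\<lambda>q. \<Psi> (snd q))"
    by (rule continuous_on_compose2[OF cont continuous_on_snd[OF continuous_on_id]]) auto
  show "continuous_on ({0..1} \<times> polygons N) (\<lambda>q i. geod (\<Psi> (snd q) i) (\<Psi> (snd q) 0) (fst q))"
    by (rule continuous_on_coordinatewise_then_product,
        intro continuous_on_geod continuous_on_vertex c continuous_on_fst continuous_on_id)
       (auto simp: \<Psi> close)
  show "(\<lambda>i. geod (\<Psi> z i) (\<Psi> z 0) t) \<in> polygons N" if t: "0 \<le> t" "t \<le> 1" and z: "z \<in> polygons N" for t z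
  proof -
    have half: "dist (geod (\<Psi> z i) (\<Psi> z 0) t) (\<Psi> z 0) \<le> \<epsilon> / 2" for i
    proof -
      have "dist (geod (\<Psi> z i) (\<Psi> z 0) t) (\<Psi> z 0) = (1 - t) * dist (\<Psi> z i) (\<Psi> z 0)"
        by (intro dist_geod_right \<Psi> close z t)
      also have "\<dots> \<le> 1 * dist (\<Psi> z i) (\<Psi> z 0)"
        using t by (intro mult_right_mono) auto
      finally show ?thesis using small[OF z, of i] by simp
    qed
    have "dist (geod (\<Psi> z i) (\<Psi> z 0) t) (geod (\<Psi> z (i + 1)) (\<Psi> z 0) t) \<le> \<epsilon>" for i
      using dist_triangle2[of "geod (\<Psi> z i) (\<Psi> z 0) t" "geod (\<Psi> z (i + 1)) (\<Psi> z 0) t" "\<Psi> z 0"]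
        half[of i] half[of "i + 1"] by linarith
    then show ?thesis
      using \<Psi>[OF z] close[OF z] t by (simp add: polygons_def geod_in)
  qed
  show "(\<lambda>i. geod (\<Psi> z i) (\<Psi> z 0) 0) = \<Psi> z" if "z \<in> polygons N" for z
    using that \<Psi> close by (simp add: geod_0)
  show "(\<lambda>i. geod (\<Psi> z i) (\<Psi> z 0) 1) = (\<lambda>_. \<Psi> z 0)" if "z \<in> polygons N" for z
    using that \<Psi> close by (simp add: geod_1)
  show "fixes_constants (\<lambda>z i. geod (\<Psi> z i) (\<Psi> z 0) t)" if "0 \<le> t" "t \<le> 1" for t
    using that consts_fixed by (simp add: geod_const)
qed

text \<open>
  Without periodic geodesics, a fixed number of midpoint steps makes the energy of all polygons so
  small that each of them lies in a small ball around one of its vertices, where it can be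
  contracted. The point to which a polygon contracts depends on the polygon and is in general not
  one of its original vertices, so the base points of the loops move.
\<close>
lemma polygons_deform_to_constants:
  assumes none: "\<nexists>\<gamma>. periodic_geodesic X \<gamma>" and N: "0 < N"
  shows "\<exists>w. homotopic_with_canon fixes_constants (polygons N) (polygons N) id (\<lambda>z _. w z)"
proof -
  \<comment> \<open>With all edges at most \<open>r\<close>, going around at most \<open>N\<close> edges covers a distance of at most \<open>\<epsilon> / 2\<close>.\<close>
  define r where "r = \<epsilon> / (2 * of_int N)"
  have r: "0 < r" "of_int N * r = \<epsilon> / 2"
    using N eps_pos by (auto simp: r_def)
  have hom1: "continuous_on (polygons N) (slide (1/2))"
    using homotopic_with_imp_continuous[OF homotopic_shorten] by blast
  have "\<exists>k. \<forall>z\<in>polygons N. energy N ((slide (1/2) ^^ k) z) < r\<^sup>2"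
  proof (rule iterates_small[OF compact_polygons _ hom1 continuous_energy])
    show "slide (1/2) \<in> polygons N \<rightarrow> polygons N"
      by (auto intro: slide_polygon)
    show "0 \<le> energy N z" for z
      unfolding energy_def by (intro sum_nonneg) auto
  qed (use energy_shorten_le energy_shorten_less[OF none] N r in auto)
  then obtain k where k: "\<And>z. z \<in> polygons N \<Longrightarrow> energy N ((slide (1/2) ^^ k) z) < r\<^sup>2"
    by blast
  let ?\<Psi> = "slide (1/2) ^^ k"
  note hom = homotopic_shorten_iterate[of N k]
  have maps: "?\<Psi> \<in> polygons N \<rightarrow> polygons N"
    using homotopic_with_imp_funspace2[OF hom] .
  have "homotopic_with_canon fixes_constants (polygons N) (polygons N) ?\<Psi> (\<lambda>z _. ?\<Psi> z 0)"
  proof (rule homotopic_to_basepoint)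
    show "continuous_on (polygons N) ?\<Psi>"
      using homotopic_with_imp_continuous[OF hom] by blast
    show "fixes_constants ?\<Psi>"
      using homotopic_with_imp_property[OF hom] by blast
    show "dist (?\<Psi> z i) (?\<Psi> z 0) \<le> \<epsilon> / 2" if "z \<in> polygons N" for z i
      using dist_le_of_energy[OF _ N k[OF that] r(1), of i] maps that r(2) by auto
  qed (rule maps)
  from homotopic_with_trans[OF hom this] show ?thesis
    by (intro exI[of _ "\<lambda>z. ?\<Psi> z 0"])
qed

end

section \<open>Spheroids\<close>

abbreviation cube :: "nat \<Rightarrow> (nat \<Rightarrow> real) set" where
  "cube n \<equiv> topspace (unit_cube n)"

lemma cube_iff: "x \<in> cube n \<longleftrightarrow> (\<forall>i. if i < n then 0 \<le> x i \<and> x i \<le> 1 else x i = undefined)"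
  by (auto simp: unit_cube_def PiE_iff extensional_def)

text \<open>
  Points of the cube are \<open>undefined\<close> outside of \<open>{..<n}\<close>, so there the full product topology on
  functions adds only constant coordinates. With this, continuity and compactness on the cube can
  be treated with the type class notions.
\<close>
lemma unit_cube_eq: "unit_cube n = top_of_set (cube n)"
proof -
  have "continuous_map (unit_cube n) euclidean (\<lambda>x. x i)" for i
  proof (cases "i < n")
    case True
    then have "continuous_map (unit_cube n) (top_of_set {0..1}) (\<lambda>x. x i)"
      unfolding unit_cube_def by (intro continuous_map_product_projection) simp
    then show ?thesis by (rule continuous_map_into_fulltopology)
  next
    case False
    then have "undefined = x i" if "x \<in> cube n" for x
      using that by (simp add: cube_iff)
    then show ?thesis
      by (rule continuous_map_eq[rotated]) simp_all
  qed
  then have "continuous_map (unit_cube n) (product_topology (\<lambda>_. euclidean) UNIV) (\<lambda>x. x)"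
    by (simp add: continuous_map_componentwise_UNIV)
  then have to: "continuous_map (unit_cube n) (top_of_set (cube n)) (\<lambda>x. x)"
    by (simp add: euclidean_product_topology continuous_map_in_subtopology)
  have "continuous_map (top_of_set (cube n)) (product_topology (\<lambda>_. top_of_set {0..1}) {..<n}) (\<lambda>x. x)"
    unfolding continuous_map_componentwise
  proof (intro conjI ballI)
    show "(\<lambda>x. x) ` topspace (top_of_set (cube n)) \<subseteq> extensional {..<n}"
      by (auto simp: cube_iff extensional_def)
    show "continuous_map (top_of_set (cube n)) (top_of_set {0..1}) (\<lambda>x. x k)" if "k \<in> {..<n}" for k
      using that by (auto simp: cube_iff continuous_map_in_subtopology
          intro: continuous_on_subset[OF continuous_on_product_coordinates])
  qed
  then have "continuous_map (top_of_set (cube n)) (unit_cube n) (\<lambda>x. x)"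
    by (simp add: unit_cube_def)
  from openin_continuous_map_preimage[OF to] openin_continuous_map_preimage[OF this]
  have "openin (unit_cube n) U \<longleftrightarrow> openin (top_of_set (cube n)) U" for U
  proof -
    assume a: "\<And>U. openin (top_of_set (cube n)) U \<Longrightarrow> openin (unit_cube n) {x \<in> cube n. x \<in> U}"
      and b: "\<And>U. openin (unit_cube n) U \<Longrightarrow>
        openin (top_of_set (cube n)) {x \<in> topspace (top_of_set (cube n)). x \<in> U}"
    show ?thesis
    proof
      assume U: "openin (unit_cube n) U"
      then have "{x \<in> topspace (top_of_set (cube n)). x \<in> U} = U"
        using openin_subset by auto
      with b[OF U] show "openin (top_of_set (cube n)) U" by metis
    next
      assume U: "openin (top_of_set (cube n)) U"
      then have "{x \<in> cube n. x \<in> U} = U"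
        using openin_subset by fastforce
      with a[OF U] show "openin (unit_cube n) U" by metis
    qed
  qed
  then show ?thesis by (simp add: topology_eq)
qed

lemma compact_cube: "compact (cube n)"
proof -
  have "compact_space (unit_cube n)"
    unfolding unit_cube_def compact_space_product_topology by (simp add: compact_space_subtopology)
  then have "compactin (top_of_set (cube n)) (cube n)"
    unfolding compact_space_def using unit_cube_eq by metis
  then show ?thesis by (simp add: compactin_subtopology)
qed

lemma cube_upd: "\<lbrakk>x \<in> cube n; 0 < n; 0 \<le> t; t \<le> 1\<rbrakk> \<Longrightarrow> x(0 := t) \<in> cube n"
  by (auto simp: cube_iff)

lemma continuous_on_fun_upd:
  assumes "continuous_on S f" "continuous_on S g"
  shows "continuous_on S (\<lambda>q. (f q :: nat \<Rightarrow> real)(0 := g q))"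
proof (rule continuous_on_coordinatewise_then_product)
  fix i :: nat
  show "continuous_on S (\<lambda>q. ((f q)(0 := g q)) i)"
    using assms continuous_on_product_then_coordinatewise[of S f i] by (cases "i = 0") auto
qed

lemma spheroid_homotopyI:
  fixes h :: "real \<Rightarrow> (nat \<Rightarrow> real) \<Rightarrow> 'a::topological_space"
  assumes cont: "continuous_on ({0..1} \<times> cube n) (\<lambda>q. h (fst q) (snd q))"
    and maps: "\<And>t x. \<lbrakk>0 \<le> t; t \<le> 1; x \<in> cube n\<rbrakk> \<Longrightarrow> h t x \<in> X"
    and "\<And>x. x \<in> cube n \<Longrightarrow> h 0 x = f x" "\<And>x. x \<in> cube n \<Longrightarrow> h 1 x = g x"
    and "\<And>t x. \<lbrakk>0 \<le> t; t \<le> 1; x \<in> unit_cube_boundary n\<rbrakk> \<Longrightarrow> h t x = p"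
  shows "(f, g) \<in> spheroid_homotopy n (top_of_set X) p"
proof -
  have "homotopic_with (\<lambda>h. h ` unit_cube_boundary n \<subseteq> {p}) (unit_cube n) (top_of_set X) f g"
  proof (subst homotopic_with)
    have "continuous_map (prod_topology (top_of_set {0..1}) (top_of_set (cube n))) (top_of_set X)
        (\<lambda>q. h (fst q) (snd q))"
      using cont maps by auto
    then show "\<exists>h. continuous_map (prod_topology (top_of_set {0..1::real}) (unit_cube n)) (top_of_set X) h \<and>
          (\<forall>x\<in>cube n. h (0, x) = f x) \<and> (\<forall>x\<in>cube n. h (1, x) = g x) \<and>
          (\<forall>t\<in>{0..1}. (\<lambda>x. h (t, x)) ` unit_cube_boundary n \<subseteq> {p})"
      using assms unfolding unit_cube_eq[symmetric]
      by (intro exI[of _ "\<lambda>q. h (fst q) (snd q)"]) auto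
  qed (auto simp: unit_cube_boundary_def)
  then show ?thesis by (simp add: spheroid_homotopy_def)
qed

text \<open>
  A spheroid is read as a family of loops at \<open>p\<close>: the loop belonging to \<open>x\<close> is \<open>t \<mapsto> f (x(0 := t))\<close>,
  and its time at \<open>x\<close> itself is the coordinate \<open>x 0\<close>. The loops are indexed redundantly by all
  points of the cube, so no lower-dimensional cube has to be split off. The number \<open>N\<close> makes the
  subdivision so fine that shortest paths between consecutive samples are unique; the bound \<open>\<epsilon> / 2\<close>
  instead of \<open>\<epsilon>\<close> leaves room for comparing the loops with the inscribed polygons.
\<close>
locale subdivided_spheroid = unique_betweenness X \<epsilon>
  for X :: "'a::metric_space set" and \<epsilon> +
  fixes n :: nat and p :: 'a and f :: "(nat \<Rightarrow> real) \<Rightarrow> 'a" and N :: int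
  assumes n_pos: "0 < n" and p_in: "p \<in> X"
    and cont_f: "continuous_on (cube n) f" and f_in: "x \<in> cube n \<Longrightarrow> f x \<in> X"
    and f_boundary: "x \<in> unit_cube_boundary n \<Longrightarrow> f x = p"
    and N_pos: "0 < N"
    and fine: "\<lbrakk>x \<in> cube n; s \<in> {0..1}; t \<in> {0..1}; \<bar>s - t\<bar> \<le> 1 / of_int N\<rbrakk> \<Longrightarrow>
      dist (f (x(0 := s))) (f (x(0 := t))) \<le> \<epsilon> / 2"
begin

definition inscribed :: "(nat \<Rightarrow> real) \<Rightarrow> int \<Rightarrow> 'a" where
  "inscribed x i = f (x(0 := of_int (i mod N) / of_int N))"

lemma grid: "0 \<le> real_of_int (i mod N) / of_int N" "real_of_int (i mod N) / of_int N \<le> 1"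
proof -
  have "0 \<le> i mod N" "i mod N < N" using N_pos by auto
  then show "0 \<le> real_of_int (i mod N) / of_int N" "real_of_int (i mod N) / of_int N \<le> 1"
    using N_pos by (simp_all add: pos_divide_le_eq less_imp_le)
qed

lemma loop_ends:
  assumes "x \<in> cube n" shows "f (x(0 := 0)) = p" "f (x(0 := 1)) = p"
  using assms n_pos cube_upd[of x n 0] cube_upd[of x n 1]
  by (auto intro!: f_boundary exI[of _ 0] simp: unit_cube_boundary_def)

lemma inscribed_step:
  assumes x: "x \<in> cube n"
  shows "dist (inscribed x i) (inscribed x (i + 1)) \<le> \<epsilon> / 2"
proof -
  define j where "j = i mod N"
  have j: "0 \<le> j" "j < N" using N_pos by (auto simp: j_def)
  have step: "(i + 1) mod N = (j + 1) mod N"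
    by (simp add: j_def mod_add_left_eq)
  have gap: "\<bar>real_of_int j / of_int N - of_int (j + 1) / of_int N\<bar> \<le> 1 / of_int N"
    using N_pos by (simp add: field_simps)
  have "dist (f (x(0 := of_int j / of_int N))) (f (x(0 := of_int (j + 1) / of_int N))) \<le> \<epsilon> / 2"
    using j by (intro fine x gap) auto
  moreover have "f (x(0 := of_int (j + 1) / of_int N)) = inscribed x (i + 1)"
  proof (cases "j + 1 = N")
    case True
    then show ?thesis
      using step loop_ends[OF x] N_pos by (simp add: inscribed_def)
  next
    case False
    then have "(i + 1) mod N = j + 1" using step j by simp
    then show ?thesis by (simp add: inscribed_def)
  qed
  ultimately show ?thesis by (simp add: inscribed_def j_def)
qed

lemma inscribed_polygon:
  assumes "x \<in> cube n" shows "inscribed x \<in> polygons N"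
proof -
  have "inscribed x i \<in> X" for i
    unfolding inscribed_def by (intro f_in cube_upd assms n_pos grid)
  moreover have "dist (inscribed x i) (inscribed x (i + 1)) \<le> \<epsilon>" for i
    using inscribed_step[OF assms, of i] eps_pos by linarith
  moreover have "inscribed x (i + N) = inscribed x i" for i
    by (simp add: inscribed_def)
  ultimately show ?thesis by (simp add: polygons_def)
qed

lemma continuous_inscribed: "continuous_on (cube n) inscribed"
  unfolding inscribed_def
  by (rule continuous_on_coordinatewise_then_product,
      rule continuous_on_compose2[OF cont_f continuous_on_fun_upd[OF continuous_on_id continuous_on_const]])
     (use cube_upd n_pos grid in auto)

text \<open>
  A boundary point either is an end point of its loop, or it lies on a side of the cube along which
  the whole loop is constant.
\<close>
lemma boundary_cases:
  assumes "x \<in> unit_cube_boundary n"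
  obtains "x 0 = 0" | "x 0 = 1" | "inscribed x = (\<lambda>_. p)"
proof -
  from assms obtain j where j: "x \<in> cube n" "j < n" "x j = 0 \<or> x j = 1"
    by (auto simp: unit_cube_boundary_def)
  show thesis
  proof (cases "j = 0")
    case False
    have "inscribed x i = p" for i
      unfolding inscribed_def
      using False j cube_upd[OF j(1) n_pos grid, of i]
      by (intro f_boundary) (auto simp: unit_cube_boundary_def intro!: exI[of _ j])
    then show thesis using that by blast
  qed (use j that in auto)
qed

lemma inscribed_0: "x \<in> cube n \<Longrightarrow> inscribed x 0 = p"
  using loop_ends by (simp add: inscribed_def)

text \<open>
  One \<open>\<epsilon> / 2\<close> leads from the spheroid to the preceding sample, and another one from there along an
  edge of the inscribed polygon.
\<close>
lemma close_to_inscribed: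
  assumes x: "x \<in> cube n"
  shows "dist (f x) (polypath (inscribed x) (of_int N * x 0)) \<le> \<epsilon>"
proof -
  let ?u = "of_int N * x 0"
  have x0: "0 \<le> x 0" "x 0 \<le> 1" using x n_pos by (auto simp: cube_iff)
  then have u: "0 \<le> ?u" "?u \<le> of_int N" using N_pos by (auto simp: mult_left_le)
  \<comment> \<open>At \<open>x 0 = 1\<close> the last edge is used: the vertex with index \<open>N\<close> is sampled at time \<open>0\<close>,
    far from time \<open>x 0\<close>.\<close>
  define i where "i = min \<lfloor>?u\<rfloor> (N - 1)"
  have i: "0 \<le> i" "i < N" "of_int i \<le> ?u" "?u \<le> of_int i + 1"
    using u N_pos unfolding i_def by linarith+
  have iN: "of_int i / of_int N \<le> x 0" "x 0 \<le> (of_int i + 1) / of_int N"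
    using i N_pos by (simp_all add: pos_divide_le_eq pos_le_divide_eq mult.commute)
  then have "\<bar>x 0 - of_int i / of_int N\<bar> \<le> 1 / of_int N"
    by (simp add: add_divide_distrib)
  then have "dist (f (x(0 := x 0))) (f (x(0 := of_int i / of_int N))) \<le> \<epsilon> / 2"
    using x0 i by (intro fine x) auto
  then have 1: "dist (f x) (inscribed x i) \<le> \<epsilon> / 2"
    using i by (simp add: inscribed_def)
  let ?s = "?u - of_int i"
  have "dist (inscribed x i) (polypath (inscribed x) ?u) = ?s * dist (inscribed x i) (inscribed x (i + 1))"
    unfolding polypath_segment[OF inscribed_polygon[OF x] i(3,4)]
    using i by (intro dist_geod_left polygonsD[OF inscribed_polygon[OF x]]) auto
  also have "\<dots> \<le> 1 * dist (inscribed x i) (inscribed x (i + 1))"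
    using i by (intro mult_right_mono) auto
  also have "\<dots> \<le> \<epsilon> / 2"
    using inscribed_step[OF x] by simp
  finally show ?thesis
    using 1 dist_triangle[of "f x" "polypath (inscribed x) ?u" "inscribed x i"] by linarith
qed

lemma polypath_ends:
  assumes "z \<in> polygons N" shows "polypath z 0 = z 0" "polypath z (of_int N) = z 0"
  using polypath_vertex[OF assms, of 0] polypath_vertex[OF assms, of N] polygonsD(2)[OF assms, of 0]
  by auto

lemma continuous_coord0: "continuous_on S (\<lambda>q. (snd q :: nat \<Rightarrow> real) 0)"
  by (rule continuous_on_product_then_coordinatewise) (intro continuous_intros)

lemma continuous_inscribed_snd: "continuous_on ({0..1} \<times> cube n) (\<lambda>q. inscribed (snd q))"
  by (rule continuous_on_compose2[OF continuous_inscribed continuous_on_snd[OF continuous_on_id]]) auto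

text \<open>
  Corresponding points are so close that unique shortest paths connect them.
\<close>
lemma homotopic_inscribed:
  "(f, \<lambda>x. polypath (inscribed x) (of_int N * x 0)) \<in> spheroid_homotopy n (top_of_set X) p"
proof (rule spheroid_homotopyI[where h = "\<lambda>t x. geod (f x) (polypath (inscribed x) (of_int N * x 0)) t"])
  let ?P = "\<lambda>x. polypath (inscribed x) (of_int N * x 0)"
  have x0: "0 \<le> x 0 \<and> x 0 \<le> 1" if "x \<in> cube n" for x
    using that n_pos by (auto simp: cube_iff)
  have P: "?P x \<in> X" if "x \<in> cube n" for x
    using that by (intro polypath_in[OF inscribed_polygon])
  have "continuous_on ({0..1} \<times> cube n) (\<lambda>q. (inscribed (snd q), of_int N * snd q 0))"
    by (intro continuous_on_Pair continuous_inscribed_snd continuous_on_mult continuous_on_const continuous_coord0)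
  then have contP: "continuous_on ({0..1::real} \<times> cube n) (\<lambda>q. ?P (snd q))"
    using x0 N_pos inscribed_polygon
    by (intro continuous_on_compose2[OF continuous_polypath[of N], where f = "\<lambda>q. (inscribed (snd q), of_int N * snd q 0)", simplified])
       (auto simp: mult_left_le)
  show "continuous_on ({0..1} \<times> cube n) (\<lambda>q. geod (f (snd q)) (?P (snd q)) (fst q))"
    using close_to_inscribed P f_in
    by (intro continuous_on_geod contP continuous_on_fst continuous_on_id
        continuous_on_compose2[OF cont_f continuous_on_snd[OF continuous_on_id]]) auto
  show "geod (f x) (?P x) t \<in> X" if "0 \<le> t" "t \<le> 1" "x \<in> cube n" for t x
    using that by (intro geod_in f_in P close_to_inscribed)
  show "geod (f x) (?P x) 0 = f x" "geod (f x) (?P x) 1 = ?P x" if "x \<in> cube n" for x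
    using that by (simp_all add: geod_0 geod_1 f_in P close_to_inscribed)
  show "geod (f x) (?P x) t = p" if t: "0 \<le> t" "t \<le> 1" and x: "x \<in> unit_cube_boundary n" for t x
  proof -
    have xc: "x \<in> cube n" using x by (simp add: unit_cube_boundary_def)
    from x have "?P x = p"
      by (cases rule: boundary_cases)
         (auto simp: polypath_ends[OF inscribed_polygon[OF xc]] inscribed_0[OF xc] polypath_const p_in)
    then show ?thesis
      using f_boundary[OF x] t p_in by (simp add: geod_const)
  qed
qed

text \<open>
  The curve \<open>t \<mapsto> (ramp t, sweep t)\<close> runs through three sides of the unit square, from \<open>(0, 0)\<close> over
  \<open>(1, 0)\<close> and \<open>(1, 1)\<close> to \<open>(0, 1)\<close>. The remaining side joins the same end points directly. For a free
  homotopy of a loop, with the stage of the homotopy as first coordinate and the time of the loop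
  as second one, that remaining side is the original loop, while the three sides are the track of
  the base point, the final loop, and the reversed track.
\<close>
definition ramp :: "real \<Rightarrow> real" where
  "ramp t = min 1 (min (3 * t) (3 * (1 - t)))"

definition sweep :: "real \<Rightarrow> real" where
  "sweep t = max 0 (min 1 (3 * t - 1))"

lemma ramp_bounds: "\<lbrakk>0 \<le> t; t \<le> 1\<rbrakk> \<Longrightarrow> 0 \<le> ramp t \<and> ramp t \<le> 1"
  and ramp_ends: "ramp 0 = 0" "ramp 1 = 0"
  and sweep_bounds: "0 \<le> sweep t" "sweep t \<le> 1"
  and sweep_ends: "sweep 0 = 0" "sweep 1 = 1"
  and ramp_sweep: "ramp t = 1 \<or> sweep t = 0 \<or> sweep t = 1"
  by (auto simp: ramp_def sweep_def min_def max_def)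

text \<open>
  The contraction of polygons moves the base points of the loops. In the square of stages and
  times, the straight homotopy from the side \<open>t \<mapsto> (0, t)\<close> to the curve \<open>t \<mapsto> (ramp t, sweep t)\<close> keeps
  the end points fixed, where the value is \<open>p\<close>. As the final loop is constant, the new loop follows
  the track of the base point and returns along the same track, so it can be retracted to \<open>p\<close>.
\<close>
lemma null_homotopic_of_contraction:
  assumes hom: "homotopic_with_canon fixes_constants (polygons N) (polygons N) id (\<lambda>z _. w z)"
  shows "(f, \<lambda>_. p) \<in> spheroid_homotopy n (top_of_set X) p"
proof -
  let ?H = "spheroid_homotopy n (top_of_set X) p"
  obtain G :: "real \<times> (int \<Rightarrow> 'a) \<Rightarrow> int \<Rightarrow> 'a"
    where contG: "continuous_on ({0..1} \<times> polygons N) G"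
    and G: "\<And>t z. \<lbrakk>0 \<le> t; t \<le> 1; z \<in> polygons N\<rbrakk> \<Longrightarrow> G (t, z) \<in> polygons N"
    and G0: "\<And>z. G (0, z) = z" and G1: "\<And>z. G (1, z) = (\<lambda>_. w z)"
    and Gc: "\<And>t x. \<lbrakk>0 \<le> t; t \<le> 1; x \<in> X\<rbrakk> \<Longrightarrow> G (t, \<lambda>_. x) = (\<lambda>_. x)"
  proof -
    obtain G :: "real \<times> (int \<Rightarrow> 'a) \<Rightarrow> int \<Rightarrow> 'a" where
      "continuous_map (prod_topology (top_of_set {0..1}) (top_of_set (polygons N))) (top_of_set (polygons N)) G"
      "\<forall>z. G (0, z) = id z" "\<forall>z. G (1, z) = (\<lambda>_. w z)"
      "\<forall>t\<in>{0..1}. fixes_constants (\<lambda>z. G (t, z))"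
      using hom unfolding homotopic_with_def by blast
    then show thesis
      by (intro that[of G]) (auto simp: Pi_iff)
  qed
  \<comment> \<open>\<open>?L u x\<close> is the polygon of \<open>x\<close> at stage \<open>u * ramp (x 0)\<close> of the contraction, \<open>?v u x\<close> the time
    at which it is evaluated in the first homotopy \<open>?K\<close>.\<close>
  let ?L = "\<lambda>u x. G (u * ramp (x 0), inscribed x)"
  have x0: "0 \<le> x 0" "x 0 \<le> 1" if "x \<in> cube n" for x
    using that n_pos by (auto simp: cube_iff)
  have ur: "0 \<le> u * ramp (x 0)" "u * ramp (x 0) \<le> 1" if "x \<in> cube n" "0 \<le> u" "u \<le> 1" for u x
    using ramp_bounds[OF x0[OF that(1)]] that by (auto simp: mult_le_one)
  have L: "?L u x \<in> polygons N" if "x \<in> cube n" "0 \<le> u" "u \<le> 1" for u x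
    using that by (intro G ur inscribed_polygon)
  have contL: "continuous_on ({0..1} \<times> cube n) (\<lambda>q. ?L (fst q) (snd q))"
  proof (rule continuous_on_compose2[OF contG])
    show "continuous_on ({0..1} \<times> cube n) (\<lambda>q. (fst q * ramp (snd q 0), inscribed (snd q)))"
      unfolding ramp_def
      by (intro continuous_on_Pair continuous_inscribed_snd continuous_on_mult continuous_on_min
          continuous_on_diff continuous_on_const continuous_coord0 continuous_on_fst continuous_on_id)
  qed (use ur inscribed_polygon in auto)
  have L_boundary: "?L u x 0 = p \<and> (?L u x = (\<lambda>_. p) \<or> x 0 = 0 \<or> x 0 = 1)"
    if "0 \<le> u" "u \<le> 1" and x: "x \<in> unit_cube_boundary n" for u x
  proof -
    have xc: "x \<in> cube n" using x by (simp add: unit_cube_boundary_def)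
    from x show ?thesis
    proof (cases rule: boundary_cases)
      case 3
      then show ?thesis using Gc[OF ur[OF xc that(1,2)] p_in] by simp
    qed (use ramp_ends inscribed_0[OF xc] G0 in auto)
  qed
  let ?v = "\<lambda>u x. (1 - u) * x 0 + u * sweep (x 0)"
  let ?K = "\<lambda>u x. polypath (?L u x) (of_int N * ?v u x)"
  have v: "0 \<le> ?v u x" "?v u x \<le> 1" if "x \<in> cube n" "0 \<le> u" "u \<le> 1" for u x
    using x0[OF that(1)] sweep_bounds[of "x 0"] that
    by (auto intro!: convex_bound_le add_nonneg_nonneg mult_nonneg_nonneg)
  have "(\<lambda>x. ?K 0 x, \<lambda>x. ?K 1 x) \<in> ?H"
  proof (rule spheroid_homotopyI[where h = ?K])
    show "continuous_on ({0..1} \<times> cube n) (\<lambda>q. ?K (fst q) (snd q))"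
    proof (rule continuous_on_compose2[OF continuous_polypath, where f = "\<lambda>q. (?L (fst q) (snd q), of_int N * ?v (fst q) (snd q))", simplified])
      show "continuous_on ({0..1} \<times> cube n) (\<lambda>q. (?L (fst q) (snd q), of_int N * ?v (fst q) (snd q)))"
        unfolding sweep_def
        by (intro continuous_on_Pair contL continuous_on_mult continuous_on_add continuous_on_min
            continuous_on_max continuous_on_diff continuous_on_const continuous_coord0
            continuous_on_fst continuous_on_id)
      show "(\<lambda>q. (?L (fst q) (snd q), of_int N * ?v (fst q) (snd q))) ` ({0..1} \<times> cube n)
          \<subseteq> polygons N \<times> {0..of_int N}"
        using L v N_pos by (auto simp: mult_left_le)
    qed
    show "?K u x \<in> X" if "0 \<le> u" "u \<le> 1" "x \<in> cube n" for u x
      using that by (intro polypath_in[OF L])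
    show "?K u x = p" if u: "0 \<le> u" "u \<le> 1" and x: "x \<in> unit_cube_boundary n" for u x
    proof -
      have xc: "x \<in> cube n" using x by (simp add: unit_cube_boundary_def)
      from L_boundary[OF u x] consider "?L u x = (\<lambda>_. p)" | "x 0 = 0 \<or> x 0 = 1" by blast
      then show ?thesis
      proof cases
        case 1
        show ?thesis unfolding 1 by (rule polypath_const[OF p_in])
      next
        case 2
        then have "?v u x = 0 \<or> ?v u x = 1" by (auto simp: sweep_ends)
        then have "?K u x = ?L u x 0"
          using polypath_ends[OF L[OF xc u]] by auto
        then show ?thesis using L_boundary[OF u x] by simp
      qed
    qed
  qed auto
  moreover have "(f, \<lambda>x. ?K 0 x) \<in> ?H"
    using homotopic_inscribed by (simp add: G0)
  moreover have "(\<lambda>x. ?K 1 x, \<lambda>_. p) \<in> ?H"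
  proof (rule spheroid_homotopyI[where h = "\<lambda>u x. ?L (1 - u) x 0"])
    show "continuous_on ({0..1::real} \<times> cube n) (\<lambda>q. ?L (1 - fst q) (snd q) 0)"
    proof (rule continuous_on_vertex, rule continuous_on_compose2[OF contL, where f = "\<lambda>q. (1 - fst q, snd q)", simplified])
      show "continuous_on ({0..1::real} \<times> cube n) (\<lambda>q. (1 - fst q, snd q))"
        by (intro continuous_intros)
    qed auto
    show "?L (1 - u) x 0 \<in> X" if "0 \<le> u" "u \<le> 1" "x \<in> cube n" for u x
      using that by (intro polygonsD(1)[of _ N] L) auto
    show "?L (1 - u) x 0 = p" if "0 \<le> u" "u \<le> 1" "x \<in> unit_cube_boundary n" for u x
      using L_boundary[of "1 - u" x] that by simp
    fix x assume x: "x \<in> cube n"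
    show "?L (1 - 1) x 0 = p"
      by (simp add: G0 inscribed_0[OF x])
    show "?L (1 - 0) x 0 = ?K 1 x"
    proof -
      have L1: "?L 1 x \<in> polygons N" by (rule L[OF x]) simp_all
      consider "ramp (x 0) = 1" | "sweep (x 0) = 0" | "sweep (x 0) = 1"
        using ramp_sweep by blast
      then show ?thesis
      proof cases
        case 1
        then show ?thesis
          using polygonsD(1)[OF L1, of 0] by (simp add: G1 polypath_const)
      qed (use polypath_ends[OF L1] in auto)
    qed
  qed
  ultimately show ?thesis
    using equiv_spheroid_homotopy[of n "top_of_set X" p] by (meson equivE transE)
qed

end

context unique_betweenness
begin

text \<open>
  Uniform continuity on the compact cube gives one \<open>N\<close> for all loops of the family.
\<close>
lemma spheroid_subdivision:
  assumes "0 < n" "p \<in> X" "f \<in> spheroids n (top_of_set X) p"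
  obtains N where "subdivided_spheroid X \<epsilon> n p f N"
proof -
  have f: "continuous_on (cube n) f" "\<And>x. x \<in> cube n \<Longrightarrow> f x \<in> X"
    "\<And>x. x \<in> unit_cube_boundary n \<Longrightarrow> f x = p"
    using assms(3) unit_cube_eq[of n] unfolding spheroids_def
    by (auto simp: continuous_map_in_subtopology Pi_iff image_subset_iff) (metis continuous_map_iff_continuous)
  let ?F = "\<lambda>q. f ((fst q)(0 := snd q))"
  have "continuous_on (cube n \<times> {0..1}) ?F"
    by (rule continuous_on_compose2[OF f(1)])
       (use assms(1) cube_upd in \<open>auto intro!: continuous_on_fun_upd continuous_on_fst continuous_on_snd continuous_on_id\<close>)
  moreover have "compact (cube n \<times> {0..1::real})"
    by (intro compact_Times compact_cube) simp
  ultimately have "uniformly_continuous_on (cube n \<times> {0..1}) ?F"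
    by (rule compact_uniformly_continuous)
  then obtain \<delta> where "0 < \<delta>" and \<delta>: "\<And>q r. \<lbrakk>q \<in> cube n \<times> {0..1}; r \<in> cube n \<times> {0..1}; dist r q < \<delta>\<rbrakk>
      \<Longrightarrow> dist (?F r) (?F q) < \<epsilon> / 2"
    unfolding uniformly_continuous_on_def using eps_pos by (metis half_gt_zero)
  obtain m :: nat where m: "1 / \<delta> < real m"
    using reals_Archimedean2 by blast
  moreover have "0 < 1 / \<delta>" using \<open>0 < \<delta>\<close> by simp
  ultimately have "0 < real m" by linarith
  then have m': "0 < m" "1 / real m < \<delta>"
    using m \<open>0 < \<delta>\<close> by (auto simp: field_simps)
  have "subdivided_spheroid X \<epsilon> n p f (int m)"
  proof unfold_locales
    fix x and s t :: real
    assume "x \<in> cube n" "s \<in> {0..1}" "t \<in> {0..1}" "\<bar>s - t\<bar> \<le> 1 / real_of_int (int m)"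
    then show "dist (f (x(0 := s))) (f (x(0 := t))) \<le> \<epsilon> / 2"
      using \<delta>[of "(x, t)" "(x, s)"] m' by (simp add: dist_Pair_Pair dist_real_def)
  qed (use assms f m' in auto)
  then show thesis by (rule that)
qed

end

theorem theorem5p1:
  fixes X :: "'a::metric_space set" and p :: 'a and n :: nat
  assumes "compact X"
    and "locally_uniquely_geodesic X"
    and "n \<ge> 1"
    and "p \<in> X"
    and "nontrivial_homotopy_group n (top_of_set X) p"
  shows "\<exists>\<gamma>. periodic_geodesic X \<gamma>"
proof (rule ccontr)
  assume none: "\<nexists>\<gamma>. periodic_geodesic X \<gamma>"
  let ?S = "spheroids n (top_of_set X) p" and ?H = "spheroid_homotopy n (top_of_set X) p"
  from locally_uniquely_geodesic_between[OF assms(2)] obtain \<epsilon> where "0 < \<epsilon>"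
    and between: "\<forall>x\<in>X. \<forall>y\<in>X. \<forall>t\<in>{0..1}. dist x y \<le> \<epsilon> \<longrightarrow>
      (\<exists>!w. w \<in> X \<and> dist x w = t * dist x y \<and> dist w y = (1 - t) * dist x y)"
    by blast
  interpret unique_betweenness X \<epsilon>
    by unfold_locales (use assms(1) \<open>0 < \<epsilon>\<close> between in auto)
  have null: "(f, \<lambda>_. p) \<in> ?H" if f: "f \<in> ?S" for f
  proof -
    obtain N where "subdivided_spheroid X \<epsilon> n p f N"
      using spheroid_subdivision[OF _ assms(4) f] assms(3) by auto
    then interpret subdivided_spheroid X \<epsilon> n p f N .
    show ?thesis
      using polygons_deform_to_constants[OF none N_pos] null_homotopic_of_contraction by blast
  qed
  have eq: "equiv ?S ?H"
    by (rule equiv_spheroid_homotopy)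
  have const: "(\<lambda>_. p) \<in> ?S"
    by (rule const_in_spheroids) (use assms(4) in simp)
  have "c = ?H `` {\<lambda>_. p}" if "c \<in> ?S // ?H" for c
    using that null equiv_class_eq[OF eq] by (auto elim!: quotientE)
  moreover have "?H `` {\<lambda>_. p} \<in> ?S // ?H"
    using const by (rule quotientI)
  ultimately have "homotopy_classes n (top_of_set X) p = {?H `` {\<lambda>_. p}}"
    unfolding homotopy_classes_def by blast
  then show False
    using assms(5) by (simp add: nontrivial_homotopy_group_def)
qed

end
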